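(* The limiting distribution $$\hat H_\infty(s)=\lim_{t\to\infty}\hat H_t(s),\qquad s\ge0,$$ exists (that is, the limit exists for every $s\ge0$ and $\hat H_\infty$ is the cumulative distribution function of a probability distribution on $[0,\infty)$) if and only if $\mu'(t)$ is a regularly varying function of some index $\rho\le0$, and in this case $\hat H_\infty$ is of the form $$\hat H_\infty(s)=\begin{cases}1-(1-s)^\gamma & s<1\\ 1 & s\ge1,\end{cases}$$ where $\gamma=-\rho$. In particular, in this case $$\lim_{t\to\infty}\frac{E[T_t]}{t}=\lim_{t\to\infty}E[\hat T_t]=\frac{1}{\gamma+1},\qquad\lim_{t\to\infty}\frac{\mathrm{Var}[T_t]}{t^2}=\lim_{t\to\infty}\mathrm{Var}[\hat T_t]=\frac{\gamma}{(\gamma+1)^2(\gamma+2)}.$$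
   Context: Data: $\lambda>0$; $F,F_0$ are cumulative distribution functions (CDFs) on $\mathbb{R}$ (offer distribution and residual price distribution); $X\sim F$, $X_0\sim F_0$; $y_+=\max(y,0)$; $\mu_0=E[X_0]$; $M=\sup\{x : F(x)<1\}\in(-\infty,+\infty]$. Standing assumptions: $E[X_+]<\infty$, $E[|X_0|]<\infty$, $0\le\mu_0<M$. A measurable function $R:[0,\infty)\to[0,\infty)$ is regularly varying with exponent (index) $\rho$ if $\lim_{s\to\infty}\frac{R(xs)}{R(s)}=x^\rho$ for all $x>0$. Define $\phi(x)=\int_x^\infty[1-F(u)]\,du$ and $\Psi(x)=\int_{\mu_0}^x\frac{du}{\phi(u)}$ for $x\in[\mu_0,M)$. The optimal policy is the function $\mu:[0,\infty)\to[\mu_0,M)$, $\mu(t)=\Psi^{-1}(\lambda t)$; equivalently, the solution of $\mu'(t)=\lambda\phi(\mu(t))$, $\mu(0)=\mu_0$. Bidding process with marketing period $t\ge 0$ under the optimal policy: let $D_1,D_2,\dots$ be exponential with rate $\lambda$ (inter-arrival times of offers) and $X_1,X_2,\dots$ be distributed according to $F$ (offer values), all independent. The time remaining to the deadline when the $i$-th offer arrives is $t_i=\max(t_{i-1}-D_i,0)$, with initial value $t$ (that is, $t_i=(t-D_1-\dots-D_i)_+$). An offer $X_i$ with $t_i>0$ is accepted if and only if $X_i\ge\mu(t_i)$; at the first accepted offer $i$ the process ends, with time to sale $T_t=t-t_i$. If no offer is accepted before the remaining time reaches $0$, then $T_t=t$. For $t>0$, $\hat T_t=\frac1tT_t\in[0,1]$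 and $\hat H_t(s)=P(\hat T_t\le s)$. *)

theory Defs
  imports "HOL-Probability.Probability"
begin

definition is_cdf :: "(real \<Rightarrow> real) \<Rightarrow> bool" where
  "is_cdf F \<longleftrightarrow> (\<exists>N. real_distribution N \<and> cdf N = F)"

(* H stands for a function on [0,\<infinity>); its values at negative arguments play no role. *)
definition is_cdf_on_half_line :: "(real \<Rightarrow> real) \<Rightarrow> bool" where
  "is_cdf_on_half_line H \<longleftrightarrow>
     (\<exists>N. real_distribution N \<and> measure N {..<0} = 0 \<and> (\<forall>s\<ge>0. H s = cdf N s))"

(* R is meant as a function [0,\<infinity>) \<rightarrow> [0,\<infinity>). Since the limit x powr rho is positive and
   division by zero yields 0, convergence forces R s \<noteq> 0 for all large s. *)
definition regularly_varying :: "(real \<Rightarrow> real) \<Rightarrow> real \<Rightarrow> bool" where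
  "regularly_varying R \<rho> \<longleftrightarrow>
     R \<in> borel_measurable (restrict_space borel {0..}) \<and>
     (\<forall>t\<ge>0. 0 \<le> R t) \<and>
     (\<forall>x>0. ((\<lambda>s. R (x * s) / R s) \<longlongrightarrow> x powr \<rho>) at_top)"

definition dist_mean :: "(real \<Rightarrow> real) \<Rightarrow> real" where
  "dist_mean F = (LINT x|interval_measure F. x)"

definition upper_end :: "(real \<Rightarrow> real) \<Rightarrow> ereal" where
  "upper_end F = (SUP x\<in>{x. F x < 1}. ereal x)"

definition phi :: "(real \<Rightarrow> real) \<Rightarrow> real \<Rightarrow> real" where
  "phi F x = (LBINT u:{x..}. 1 - F u)"

definition Psi :: "(real \<Rightarrow> real) \<Rightarrow> (real \<Rightarrow> real) \<Rightarrow> real \<Rightarrow> real" where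
  "Psi F F0 x = (LBINT u:{dist_mean F0..x}. 1 / phi F u)"

(* Under the standing assumptions Psi maps [mu_0, M) bijectively onto [0,\<infinity>), where
   mu_0 = dist_mean F0 and M = upper_end F. *)
definition opt_policy :: "real \<Rightarrow> (real \<Rightarrow> real) \<Rightarrow> (real \<Rightarrow> real) \<Rightarrow> real \<Rightarrow> real" where
  "opt_policy lam F F0 t =
     the_inv_into {x. dist_mean F0 \<le> x \<and> ereal x < upper_end F} (Psi F F0) (lam * t)"

(* One-sided at the end point t = 0, since the policy lives on [0,\<infinity>). *)
definition opt_policy_deriv :: "real \<Rightarrow> (real \<Rightarrow> real) \<Rightarrow> (real \<Rightarrow> real) \<Rightarrow> real \<Rightarrow> real" where
  "opt_policy_deriv lam F F0 t = vector_derivative (opt_policy lam F F0) (at t within {0..})"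

(* Offers are numbered 1, 2, ...; the entries D 0 and X 0 are never used. *)
primrec time_remaining :: "(nat \<Rightarrow> real) \<Rightarrow> real \<Rightarrow> nat \<Rightarrow> real" where
  "time_remaining d t 0 = t"
| "time_remaining d t (Suc i) = max (time_remaining d t i - d (Suc i)) 0"

definition accepted :: "(real \<Rightarrow> real) \<Rightarrow> (nat \<Rightarrow> real) \<Rightarrow> (nat \<Rightarrow> real) \<Rightarrow> real \<Rightarrow> nat \<Rightarrow> bool" where
  "accepted \<mu> d x t i \<longleftrightarrow>
     1 \<le> i \<and> 0 < time_remaining d t i \<and> \<mu> (time_remaining d t i) \<le> x i"

definition sale_time ::
  "(real \<Rightarrow> real) \<Rightarrow> (nat \<Rightarrow> 'w \<Rightarrow> real) \<Rightarrow> (nat \<Rightarrow> 'w \<Rightarrow> real) \<Rightarrow> real \<Rightarrow> 'w \<Rightarrow> real" where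
  "sale_time \<mu> D X t \<omega> =
     (let d = (\<lambda>i. D i \<omega>); x = (\<lambda>i. X i \<omega>)
      in if \<exists>i. accepted \<mu> d x t i
         then t - time_remaining d t (LEAST i. accepted \<mu> d x t i)
         else t)"

definition scaled_sale_time ::
  "(real \<Rightarrow> real) \<Rightarrow> (nat \<Rightarrow> 'w \<Rightarrow> real) \<Rightarrow> (nat \<Rightarrow> 'w \<Rightarrow> real) \<Rightarrow> real \<Rightarrow> 'w \<Rightarrow> real" where
  "scaled_sale_time \<mu> D X t \<omega> = 1 / t * sale_time \<mu> D X t \<omega>"

definition scaled_cdf ::
  "'w measure \<Rightarrow> (real \<Rightarrow> real) \<Rightarrow> (nat \<Rightarrow> 'w \<Rightarrow> real) \<Rightarrow> (nat \<Rightarrow> 'w \<Rightarrow> real) \<Rightarrow> real \<Rightarrow> real \<Rightarrow> real"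
  where
  "scaled_cdf \<Omega> \<mu> D X t s = measure \<Omega> {\<omega> \<in> space \<Omega>. scaled_sale_time \<mu> D X t \<omega> \<le> s}"

definition is_limiting_distribution ::
  "'w measure \<Rightarrow> (real \<Rightarrow> real) \<Rightarrow> (nat \<Rightarrow> 'w \<Rightarrow> real) \<Rightarrow> (nat \<Rightarrow> 'w \<Rightarrow> real) \<Rightarrow> (real \<Rightarrow> real) \<Rightarrow> bool"
  where
  "is_limiting_distribution \<Omega> \<mu> D X H \<longleftrightarrow>
     (\<forall>s\<ge>0. ((\<lambda>t. scaled_cdf \<Omega> \<mu> D X t s) \<longlongrightarrow> H s) at_top) \<and> is_cdf_on_half_line H"

end

theory Submission
  imports Defs
begin

text \<open>
  The whole statement rests on one exact formula: for \<open>0 \<le> s < t\<close>,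
  \<open>P(T_t > s) = \<mu>'(t) / \<mu>'(t - s)\<close>.
  Heuristically, offers that would be accepted arrive as a Poisson process whose intensity, with
  remaining time \<open>u\<close>, is \<open>\<lambda> P(X \<ge> \<mu>(u))\<close>; and since \<open>\<mu>' = \<lambda> \<phi>(\<mu>)\<close> and \<open>\<phi>' = -(1 - F)\<close> off the
  countably many atoms of \<open>F\<close>, this intensity is the logarithmic derivative of \<open>1 / \<mu>'\<close>.

  The formula is proved by a martingale (lemma \<open>martingale\<close>), which avoids both the Poisson process
  and any conditioning on the number of arrivals. Fix a threshold \<open>c > 0\<close> for the remaining time and
  put \<open>G(v) = \<mu>'(max v c) / \<mu>'(c)\<close>, the conjectured probability of getting from remaining time \<open>v\<close>
  down to \<open>c\<close> without a sale. Conditioning on the next offer alone reproduces \<open>G\<close> (lemma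
  \<open>one_step\<close>); this renewal identity is integration of an exact derivative. Hence the expectation of
  the indicator of ``no sale at remaining time at least \<open>c\<close> among the first \<open>n\<close> offers'' times \<open>G\<close>
  of the remaining time after offer \<open>n\<close> does not depend on \<open>n\<close>. It equals \<open>G(t)\<close> for \<open>n = 0\<close>, and
  for \<open>n \<rightarrow> \<infinity>\<close> the remaining time reaches zero, where \<open>G = 1\<close>.

  Consequently the scaled distribution function at \<open>s < 1\<close> is \<open>1 - \<mu>'(t) / \<mu>'((1 - s) t)\<close>, so that
  it converges for every \<open>s\<close> exactly if the ratios \<open>\<mu>'(t) / \<mu>'(x t)\<close> converge for \<open>0 < x \<le> 1\<close>.
  Such a limit is multiplicative and monotone in \<open>x\<close>, and therefore either a power \<open>x\<^sup>\<gamma>\<close> with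
  \<open>\<gamma> \<ge> 0\<close> or identically zero below \<open>1\<close> (lemma \<open>monotone_ratio_limit_powr\<close>). In the second case
  the limiting distribution function would vanish at \<open>0\<close> and be one immediately after it, which
  contradicts right continuity. The moments follow from the tail formula for expectations by
  dominated convergence.
\<close>

section \<open>Limits of ratios of monotone functions\<close>

text \<open>
  A nonnegative additive function is monotone, and monotonicity replaces the continuity that Cauchy's
  functional equation needs: trapping \<open>n * u\<close> between consecutive integers determines \<open>g u\<close> up to an
  error of \<open>g 1 / n\<close>.
\<close>

lemma additive_nonneg_imp_linear:
  fixes g :: "real \<Rightarrow> real"
  assumes add: "\<And>u v. 0 \<le> u \<Longrightarrow> 0 \<le> v \<Longrightarrow> g (u + v) = g u + g v"
    and nonneg: "\<And>u. 0 \<le> u \<Longrightarrow> 0 \<le> g u"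
    and u: "0 \<le> u"
  shows "g u = u * g 1"
proof -
  have mult: "g (real n * v) = real n * g v" if "0 \<le> v" for n v
  proof (induction n)
    case 0
    show ?case using add[of 0 0] by simp
  next
    case (Suc n)
    then show ?case using add[of "real n * v" v] that by (simp add: algebra_simps)
  qed
  have mono: "g v \<le> g w" if "0 \<le> v" "v \<le> w" for v w
    using add[of v "w - v"] nonneg[of "w - v"] that by simp
  have "\<bar>g u - u * g 1\<bar> = 0"
  proof (rule real_archimedian_rdiv_eq_0)
    fix n :: nat assume "0 < n"
    define k where "k = nat \<lfloor>real n * u\<rfloor>"
    have k: "real k \<le> real n * u" "real n * u \<le> real (Suc k)"
      using u by (simp_all add: k_def) linarith
    have "real k * g 1 \<le> real n * g u"
      using mono[OF _ k(1)] mult[of 1 k] mult[of u n] u by simp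
    moreover have "real n * g u \<le> real (Suc k) * g 1"
      using mono[OF _ k(2)] mult[of 1 "Suc k"] mult[of u n] u by simp
    moreover have "real k * g 1 \<le> (real n * u) * g 1" "(real n * u) * g 1 \<le> real (Suc k) * g 1"
      using k nonneg[of 1] by (auto intro!: mult_right_mono simp del: of_nat_Suc)
    ultimately have "\<bar>real n * g u - (real n * u) * g 1\<bar> \<le> g 1"
      by (simp add: algebra_simps abs_le_iff)
    moreover have "real n * \<bar>g u - u * g 1\<bar> = \<bar>real n * g u - (real n * u) * g 1\<bar>"
      using abs_mult[of "real n" "g u - u * g 1"] by (simp add: algebra_simps)
    ultimately show "real n * \<bar>g u - u * g 1\<bar> \<le> g 1" by simp
  qed (auto intro: nonneg)
  then show ?thesis by simp
qed

text \<open>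
  The substitution \<open>x = exp (- u)\<close> turns multiplicativity on the unit interval into additivity on the
  half line, and the bound by one into nonnegativity.
\<close>

lemma multiplicative_le_one_imp_powr:
  fixes G :: "real \<Rightarrow> real"
  assumes mult: "\<And>x y. 0 < x \<Longrightarrow> x \<le> 1 \<Longrightarrow> 0 < y \<Longrightarrow> y \<le> 1 \<Longrightarrow> G (x * y) = G x * G y"
    and pos: "\<And>x. 0 < x \<Longrightarrow> x \<le> 1 \<Longrightarrow> 0 < G x"
    and le1: "\<And>x. 0 < x \<Longrightarrow> x \<le> 1 \<Longrightarrow> G x \<le> 1"
  obtains \<gamma> where "0 \<le> \<gamma>" "\<And>x. 0 < x \<Longrightarrow> x \<le> 1 \<Longrightarrow> G x = x powr \<gamma>"
proof
  define g where "g u = - ln (G (exp (- u)))" for u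
  have g_nonneg: "0 \<le> g u" if "0 \<le> u" for u
    using pos[of "exp (- u)"] le1[of "exp (- u)"] that by (simp add: g_def)
  have lin: "g u = u * g 1" if "0 \<le> u" for u
  proof (rule additive_nonneg_imp_linear[OF _ g_nonneg that])
    fix u v :: real assume "0 \<le> u" "0 \<le> v"
    then show "g (u + v) = g u + g v"
      using pos[of "exp (- u)"] pos[of "exp (- v)"] mult[of "exp (- u)" "exp (- v)"]
      by (simp add: g_def ln_mult_pos flip: exp_add)
  qed
  show "0 \<le> g 1" by (rule g_nonneg) simp
  fix x :: real assume x: "0 < x" "x \<le> 1"
  have "ln (G x) = ln x * g 1"
    using lin[of "- ln x"] x by (simp add: g_def)
  then have "G x = exp (ln x * g 1)"
    using pos[OF x] by (metis exp_ln)
  then show "G x = x powr g 1"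
    using x by (simp add: powr_def mult.commute)
qed

text \<open>
  Monotonicity of \<open>R\<close> makes \<open>G\<close> a monotone multiplicative function with values in the unit interval.
  A zero of \<open>G\<close> at \<open>x\<close> forces zeros at all the roots of \<open>x\<close>, which accumulate at \<open>1\<close>; by monotonicity
  \<open>G\<close> then vanishes on the whole open interval, and this is what the last hypothesis excludes.
\<close>

lemma monotone_ratio_limit_powr:
  fixes R G :: "real \<Rightarrow> real"
  assumes pos: "\<And>t. 0 < t \<Longrightarrow> 0 < R t"
    and anti: "\<And>s t. 0 < s \<Longrightarrow> s \<le> t \<Longrightarrow> R t \<le> R s"
    and lim: "\<And>x. 0 < x \<Longrightarrow> x \<le> 1 \<Longrightarrow> ((\<lambda>t. R t / R (x * t)) \<longlongrightarrow> G x) at_top"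
    and nontriv: "\<not> (G \<longlongrightarrow> 0) (at_left 1)"
  obtains \<gamma> where "0 \<le> \<gamma>" "\<And>x. 0 < x \<Longrightarrow> x \<le> 1 \<Longrightarrow> G x = x powr \<gamma>"
proof -
  have ratio: "0 \<le> R t / R (x * t) \<and> R t / R (x * t) \<le> 1" if "0 < x" "x \<le> 1" "0 < t" for x t
  proof -
    have "x * t \<le> t" using that by (simp add: mult_left_le_one_le)
    moreover have "0 < x * t" using that by simp
    ultimately show ?thesis
      using pos[of t] pos[of "x * t"] anti[of "x * t" t] that by simp
  qed
  have G_bounds: "0 \<le> G x" "G x \<le> 1" if "0 < x" "x \<le> 1" for x
  proof -
    show "0 \<le> G x"
      by (rule tendsto_lowerbound[OF lim[OF that]])
         (auto intro!: eventually_mono[OF eventually_gt_at_top[of 0]] dest: ratio[OF that])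
    show "G x \<le> 1"
      by (rule tendsto_upperbound[OF lim[OF that]])
         (auto intro!: eventually_mono[OF eventually_gt_at_top[of 0]] dest: ratio[OF that])
  qed
  have mult: "G (x * y) = G x * G y" if xy: "0 < x" "x \<le> 1" "0 < y" "y \<le> 1" for x y
  proof (rule tendsto_unique[of at_top])
    have "x * y \<le> 1" using xy by (simp add: mult_le_one)
    then show "((\<lambda>t. R t / R ((x * y) * t)) \<longlongrightarrow> G (x * y)) at_top"
      using lim[of "x * y"] xy by simp
    have "((\<lambda>t. R (x * t) / R (y * (x * t))) \<longlongrightarrow> G y) at_top"
      by (rule filterlim_compose[OF lim[OF xy(3,4)]])
         (use xy in \<open>intro filterlim_tendsto_pos_mult_at_top[OF tendsto_const] filterlim_ident\<close>)
    from tendsto_mult[OF lim[OF xy(1,2)] this]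
    show "((\<lambda>t. R t / R ((x * y) * t)) \<longlongrightarrow> G x * G y) at_top"
    proof (rule Lim_transform_eventually)
      show "\<forall>\<^sub>F t in at_top. R t / R (x * t) * (R (x * t) / R (y * (x * t))) = R t / R (x * y * t)"
        using eventually_gt_at_top[of 0]
      proof eventually_elim
        case (elim t)
        then have "R (x * t) \<noteq> 0" using pos[of "x * t"] xy by simp
        then show ?case by (simp add: mult_ac)
      qed
    qed
  qed (simp add: trivial_limit_at_top_linorder)
  have mono: "G x \<le> G y" if "0 < x" "x \<le> y" "y \<le> 1" for x y
    using mult[of "x / y" y] G_bounds[of "x / y"] G_bounds[of y] that
    by (simp add: mult_left_le_one_le)
  have "0 < G x" if x: "0 < x" "x \<le> 1" for x
  proof (rule ccontr)
    assume "\<not> 0 < G x"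
    then have G0: "G x = 0" using G_bounds[OF x] by simp
    have root0: "G (x powr (1 / real (Suc n))) = 0" for n
    proof -
      define z where "z = x powr (1 / real (Suc n))"
      have z: "0 < z" "z \<le> 1" using x by (auto simp: z_def powr_le1)
      have "G (z ^ Suc k) = G z ^ Suc k" for k
      proof (induction k)
        case (Suc k)
        have "G (z * z ^ Suc k) = G z * G (z ^ Suc k)"
          using z power_le_one[of z "Suc k"] by (intro mult) auto
        with Suc show ?case by simp
      qed simp
      moreover have "z ^ Suc n = x"
      proof -
        have "z ^ Suc n = z powr real (Suc n)" using z by (simp only: powr_realpow)
        also have "\<dots> = x" using x by (simp add: z_def powr_powr del: of_nat_Suc)
        finally show ?thesis .
      qed
      ultimately have "G z ^ Suc n = 0" using G0 by metis
      then have "G z = 0" using power_eq_0_iff by blast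
      then show ?thesis by (simp add: z_def)
    qed
    have zero: "G y = 0" if y: "0 < y" "y < 1" for y
    proof -
      have "(\<lambda>n. x powr (1 / real (Suc n))) \<longlonglongrightarrow> x powr 0"
        using x by (intro tendsto_powr tendsto_const LIMSEQ_Suc[OF lim_1_over_n]) auto
      then have "eventually (\<lambda>n. y < x powr (1 / real (Suc n))) sequentially"
        using x y by (auto dest: order_tendstoD)
      then obtain n where "y < x powr (1 / real (Suc n))"
        by (auto simp: eventually_sequentially)
      then have "G y \<le> 0"
        using mono[of y "x powr (1 / real (Suc n))"] root0[of n] x y by (simp add: powr_le1)
      then show ?thesis using G_bounds[of y] y by simp
    qed
    have "(G \<longlongrightarrow> 0) (at_left 1)"
    proof (rule Lim_transform_eventually[OF tendsto_const])
      show "\<forall>\<^sub>F y in at_left 1. 0 = G y"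
      proof (rule eventually_mono)
        show "\<forall>\<^sub>F y in at_left 1. y \<in> {0<..<1::real}" by (rule eventually_at_left_real) simp
      qed (simp add: zero)
    qed
    with nontriv show False ..
  qed
  then show thesis
    using multiplicative_le_one_imp_powr[of G] mult G_bounds(2) that by blast
qed

text \<open>
  Ratios at scales \<open>x \<le> 1\<close> suffice: a scale above one is the inverse of one below, seen from the
  point \<open>x * t\<close> instead of \<open>t\<close>.
\<close>

lemma regularly_varying_iff_ratio_limit:
  fixes R :: "real \<Rightarrow> real"
  assumes pos: "\<And>t. 0 \<le> t \<Longrightarrow> 0 < R t"
    and cont: "continuous_on {0..} R"
  shows "regularly_varying R \<rho> \<longleftrightarrow>
    (\<forall>x. 0 < x \<and> x \<le> 1 \<longrightarrow> ((\<lambda>t. R t / R (x * t)) \<longlongrightarrow> x powr (- \<rho>)) at_top)"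
    (is "?L \<longleftrightarrow> ?R")
proof
  assume ?L
  then have lim: "((\<lambda>t. R (x * t) / R t) \<longlongrightarrow> x powr \<rho>) at_top" if "0 < x" for x
    using that by (simp add: regularly_varying_def)
  show ?R
  proof safe
    fix x :: real assume "0 < x"
    from tendsto_inverse[OF lim[OF this]] this
    show "((\<lambda>t. R t / R (x * t)) \<longlongrightarrow> x powr (- \<rho>)) at_top"
      by (simp add: powr_minus)
  qed
next
  assume R: ?R
  have "((\<lambda>t. R (x * t) / R t) \<longlongrightarrow> x powr \<rho>) at_top" if x: "0 < x" for x
  proof (cases "x \<le> 1")
    case True
    with R x have "((\<lambda>t. R t / R (x * t)) \<longlongrightarrow> x powr (- \<rho>)) at_top" by blast
    from tendsto_inverse[OF this] x show ?thesis by (simp add: powr_minus)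
  next
    case False
    then have "((\<lambda>t. R t / R (1 / x * t)) \<longlongrightarrow> (1 / x) powr (- \<rho>)) at_top"
      using R[rule_format, of "1 / x"] x by simp
    then have "((\<lambda>t. R (x * t) / R (1 / x * (x * t))) \<longlongrightarrow> (1 / x) powr (- \<rho>)) at_top"
      by (rule filterlim_compose)
         (use x in \<open>intro filterlim_tendsto_pos_mult_at_top[OF tendsto_const] filterlim_ident\<close>)
    then show ?thesis using x by (simp add: powr_minus powr_divide)
  qed
  moreover have "R \<in> borel_measurable (restrict_space borel {0..})"
    using cont by (rule borel_measurable_continuous_on_restrict)
  ultimately show ?L using pos by (simp add: regularly_varying_def less_imp_le)
qed

section \<open>The function \<open>\<phi>\<close>\<close>

text \<open>
  A derivative criterion that serves both for \<open>\<phi>\<close>, whose increments are integrals of a monotone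
  function, and for the policy, which is an inverse function: in both cases bounds on the increments
  are at hand, and the criterion also covers one-sided derivatives.
\<close>

lemma squeezed_increments_imp_deriv:
  fixes f a :: "real \<Rightarrow> real"
  assumes lower: "\<And>s t. s \<in> S \<Longrightarrow> t \<in> S \<Longrightarrow> s \<le> t \<Longrightarrow> (t - s) * a t \<le> f t - f s"
    and upper: "\<And>s t. s \<in> S \<Longrightarrow> t \<in> S \<Longrightarrow> s \<le> t \<Longrightarrow> f t - f s \<le> (t - s) * a s"
    and cont: "continuous (at t within S) a" and t: "t \<in> S"
  shows "(f has_real_derivative a t) (at t within S)"
proof -
  have squeeze: "\<bar>(f y - f t) / (y - t) - a t\<bar> \<le> \<bar>a y - a t\<bar>" if y: "y \<in> S" "y \<noteq> t" for y
  proof (cases "t \<le> y")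
    case True
    then have "a y \<le> (f y - f t) / (y - t)" "(f y - f t) / (y - t) \<le> a t"
      using lower[OF t y(1)] upper[OF t y(1)] y by (simp_all add: field_simps)
    then show ?thesis by simp
  next
    case False
    then have "a t \<le> (f t - f y) / (t - y)" "(f t - f y) / (t - y) \<le> a y"
      using lower[OF y(1) t] upper[OF y(1) t] by (simp_all add: field_simps)
    moreover have "(f y - f t) / (y - t) = (f t - f y) / (t - y)"
      using y by (simp add: field_simps)
    ultimately show ?thesis by simp
  qed
  have "((\<lambda>y. (f y - f t) / (y - t) - a t) \<longlongrightarrow> 0) (at t within S)"
  proof (rule Lim_null_comparison)
    show "\<forall>\<^sub>F y in at t within S. norm ((f y - f t) / (y - t) - a t) \<le> \<bar>a y - a t\<bar>"
      using squeeze by (auto simp: eventually_at_filter)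
    show "((\<lambda>y. \<bar>a y - a t\<bar>) \<longlongrightarrow> 0) (at t within S)"
      using cont by (intro tendsto_rabs_zero) (simp add: continuous_within LIM_zero)
  qed
  then show ?thesis
    by (simp add: has_field_derivative_iff LIM_zero_iff)
qed

text \<open>
  Half-open intervals are used because they concatenate to disjoint unions.
\<close>

lemma set_integral_constant_bounds:
  fixes f :: "real \<Rightarrow> real"
  assumes f: "set_integrable lborel {x..<y} f" and xy: "x \<le> y"
    and lower: "\<And>u. u \<in> {x..<y} \<Longrightarrow> c \<le> f u" and upper: "\<And>u. u \<in> {x..<y} \<Longrightarrow> f u \<le> d"
  shows "(y - x) * c \<le> (LBINT u:{x..<y}. f u)" "(LBINT u:{x..<y}. f u) \<le> (y - x) * d"
proof -
  have const: "set_integrable lborel {x..<y} (\<lambda>_. k)" "(LBINT u:{x..<y}. k) = (y - x) * k" for k :: real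
    using xy by (auto simp: set_integrable_def set_lebesgue_integral_def)
  show "(y - x) * c \<le> (LBINT u:{x..<y}. f u)"
    using set_integral_mono[OF const(1)[of c] f] lower by (simp add: const)
  show "(LBINT u:{x..<y}. f u) \<le> (y - x) * d"
    using set_integral_mono[OF f const(1)[of d]] upper by (simp add: const)
qed

lemma set_integral_singleton: "(LBINT u:{x}. f u) = (0::real)"
proof -
  have "AE u in lborel. u \<noteq> x" by (rule AE_lborel_singleton)
  then show ?thesis
    unfolding set_lebesgue_integral_def by (intro integral_eq_zero_AE) auto
qed

text \<open>
  The law \<open>N\<close> of an offer is carried along with its distribution function, so that probabilities of
  half lines and values of \<open>F\<close> can be used side by side.
\<close>

locale offer_distribution =
  fixes N :: "real measure" and F :: "real \<Rightarrow> real"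
  assumes real_distribution: "real_distribution N"
    and F_eq: "F = cdf N"
    and integrable_pos_part: "integrable N (\<lambda>x. max x 0)"
begin

sublocale real_distribution N
  by (rule real_distribution)

lemma F_mono: "x \<le> y \<Longrightarrow> F x \<le> F y"
  by (simp add: F_eq cdf_nondecreasing)

lemma F_bounds: "0 \<le> F x" "F x \<le> 1"
  by (simp_all add: F_eq cdf_nonneg cdf_bounded_prob)

lemma F_measurable [measurable]: "F \<in> borel_measurable borel"
  by (intro borel_measurable_mono monoI F_mono)

lemma survival_eq: "1 - F u = prob {u<..}"
proof -
  have "prob (space N - {..u}) = 1 - prob {..u}" by (rule prob_compl) simp
  moreover have "space N - {..u} = {u<..}" by auto
  ultimately show ?thesis by (simp add: F_eq cdf_def)
qed

text \<open>
  By Tonelli's theorem the integral of the tail is the expectation of \<open>max (X - x) 0\<close>.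
\<close>

lemma survival_set_integrable: "set_integrable lborel {x..} (\<lambda>u. 1 - F u)"
proof -
  interpret pair_sigma_finite lborel N ..
  have "(\<integral>\<^sup>+ u. ennreal (indicator {x..} u * (1 - F u)) \<partial>lborel)
      = (\<integral>\<^sup>+ u. (\<integral>\<^sup>+ y. indicator {(u, y). x \<le> u \<and> u < y} (u, y) \<partial>N) \<partial>lborel)"
  proof (rule nn_integral_cong)
    fix u
    have "(\<integral>\<^sup>+ y. indicator {(u, y). x \<le> u \<and> u < y} (u, y) \<partial>N)
        = (\<integral>\<^sup>+ y. indicator {x..} u * indicator {u<..} y \<partial>N)"
      by (intro nn_integral_cong) (auto split: split_indicator)
    also have "\<dots> = ennreal (indicator {x..} u * (1 - F u))"
      by (simp add: nn_integral_cmult survival_eq emeasure_eq_measure ennreal_mult'' ennreal_indicator)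
    finally show "ennreal (indicator {x..} u * (1 - F u)) = (\<integral>\<^sup>+ y. indicator {(u, y). x \<le> u \<and> u < y} (u, y) \<partial>N)" ..
  qed
  also have "\<dots> = (\<integral>\<^sup>+ y. (\<integral>\<^sup>+ u. indicator {(u, y). x \<le> u \<and> u < y} (u, y) \<partial>lborel) \<partial>N)"
    by (rule Fubini'[symmetric]) measurable
  also have "\<dots> = (\<integral>\<^sup>+ y. ennreal (max (y - x) 0) \<partial>N)"
  proof (rule nn_integral_cong)
    fix y
    have "(\<integral>\<^sup>+ u. indicator {(u, y). x \<le> u \<and> u < y} (u, y) \<partial>lborel) = (\<integral>\<^sup>+ u. indicator {x..<y} u \<partial>lborel)"
      by (intro nn_integral_cong) (auto split: split_indicator)
    then show "(\<integral>\<^sup>+ u. indicator {(u, y). x \<le> u \<and> u < y} (u, y) \<partial>lborel) = ennreal (max (y - x) 0)"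
      by (simp add: max_def ennreal_neg)
  qed
  also have "\<dots> < \<infinity>"
  proof -
    have "integrable N (\<lambda>y. max (y - x) 0)"
      by (rule Bochner_Integration.integrable_bound[OF Bochner_Integration.integrable_add[OF integrable_pos_part integrable_const[of "\<bar>x\<bar>"]]]) auto
    then show ?thesis
      by (simp add: integrable_iff_bounded)
  qed
  finally show ?thesis
    unfolding set_integrable_def
    by (intro integrableI_bounded) (auto simp: F_bounds abs_mult)
qed

lemma phi_diff_bounds:
  assumes "x \<le> y"
  shows "(y - x) * (1 - F y) \<le> phi F x - phi F y" "phi F x - phi F y \<le> (y - x) * (1 - F x)"
proof -
  have "{x..} = {x..<y} \<union> {y..}" using assms by auto
  then have "phi F x - phi F y = (LBINT u:{x..<y}. 1 - F u)"
    unfolding phi_def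
    by (subst \<open>{x..} = _\<close>, subst set_integral_Un)
       (auto intro: set_integrable_subset[OF survival_set_integrable[of x]] assms)
  moreover have "set_integrable lborel {x..<y} (\<lambda>u. 1 - F u)"
    by (rule set_integrable_subset[OF survival_set_integrable[of x]]) auto
  ultimately show "(y - x) * (1 - F y) \<le> phi F x - phi F y" "phi F x - phi F y \<le> (y - x) * (1 - F x)"
    using set_integral_constant_bounds[of x y "\<lambda>u. 1 - F u" "1 - F y" "1 - F x"] assms
    by (simp_all add: F_mono)
qed

lemma phi_nonneg: "0 \<le> phi F x"
  unfolding phi_def set_lebesgue_integral_def
  by (intro integral_nonneg_AE) (auto simp: F_bounds)

lemma phi_antimono: "x \<le> y \<Longrightarrow> phi F y \<le> phi F x"
  using phi_diff_bounds(1)[of x y] F_bounds(2)[of y]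
  by (smt (verit) mult_nonneg_nonneg)

lemma phi_lipschitz: "\<bar>phi F x - phi F y\<bar> \<le> \<bar>x - y\<bar>"
proof -
  have "\<bar>phi F x - phi F y\<bar> \<le> y - x" if "x \<le> y" for x y
  proof -
    have "(y - x) * (1 - F x) \<le> (y - x) * 1"
      using that F_bounds[of x] by (intro mult_left_mono) auto
    then show ?thesis
      using phi_diff_bounds[OF that] phi_antimono[OF that] by simp
  qed
  from this[of x y] this[of y x] show ?thesis by linarith
qed

lemma phi_continuous: "continuous_on A (phi F)"
proof (rule continuous_on_subset)
  have "1-lipschitz_on UNIV (phi F)"
    by (rule lipschitz_onI) (auto simp: dist_real_def phi_lipschitz)
  then show "continuous_on UNIV (phi F)"
    by (rule lipschitz_on_continuous_on)
qed simp

lemma phi_measurable [measurable]: "phi F \<in> borel_measurable borel"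
  by (rule borel_measurable_continuous_onI[OF phi_continuous])

lemma phi_has_derivative:
  assumes "isCont F x"
  shows "(phi F has_real_derivative - (1 - F x)) (at x)"
proof -
  have "((\<lambda>x. - phi F x) has_real_derivative 1 - F x) (at x)"
    using assms phi_diff_bounds
    by (intro squeezed_increments_imp_deriv[where a = "\<lambda>x. 1 - F x" and S = UNIV]) (auto intro: continuous_intros)
  from DERIV_minus[OF this] show ?thesis by simp
qed

text \<open>
  This expresses the domain of \<open>\<Psi>\<close>, which is defined through an extended real, by a real inequality.
\<close>

lemma phi_pos_iff: "0 < phi F x \<longleftrightarrow> ereal x < upper_end F"
proof
  assume "ereal x < upper_end F"
  then obtain y where y: "x < y" "F y < 1"
    by (auto simp: upper_end_def less_SUP_iff)
  then have "0 < (y - x) * (1 - F y)" by simp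
  then show "0 < phi F x"
    using phi_diff_bounds(1)[of x y] phi_nonneg[of y] y by linarith
next
  assume pos: "0 < phi F x"
  show "ereal x < upper_end F"
  proof (rule ccontr)
    assume "\<not> ereal x < upper_end F"
    then have "\<not> F y < 1" if "x < y" for y
      using that by (auto simp: upper_end_def not_less SUP_le_iff)
    then have "F y = 1" if "x < y" for y
      using that F_bounds(2)[of y] by fastforce
    then have "phi F x = (LBINT u:{x}. 1 - F u)"
      unfolding phi_def set_lebesgue_integral_def
      by (intro Bochner_Integration.integral_cong) (auto split: split_indicator)
    also have "\<dots> = 0"
      by (rule set_integral_singleton)
    finally show False using pos by simp
  qed
qed

end

section \<open>The optimal policy\<close>

locale optimal_policy = offer_distribution +
  fixes lam :: real and F0 :: "real \<Rightarrow> real"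
  assumes lam_pos: "0 < lam"
    and start: "ereal (dist_mean F0) < upper_end F"
begin

abbreviation "\<mu>0 \<equiv> dist_mean F0"

abbreviation "\<mu> \<equiv> opt_policy lam F F0"

lemma phi_pos_downward: "0 < phi F y \<Longrightarrow> x \<le> y \<Longrightarrow> 0 < phi F x"
  using phi_antimono[of x y] by simp

lemma Psi_diff_bounds:
  assumes "\<mu>0 \<le> x" "x \<le> y" "0 < phi F y"
  shows "(y - x) / phi F x \<le> Psi F F0 y - Psi F F0 x" "Psi F F0 y - Psi F F0 x \<le> (y - x) / phi F y"
proof -
  have cont: "continuous_on {\<mu>0..y} (\<lambda>u. 1 / phi F u)"
    using phi_pos_downward[OF assms(3)] by (intro continuous_intros phi_continuous) force
  note int = borel_integrable_atLeastAtMost'[OF cont]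
  \<comment> \<open>Dropping the right end point makes the integral additive over disjoint intervals.\<close>
  define I where "I z = (LBINT u:{\<mu>0..<z}. 1 / phi F u)" for z
  have Psi_I: "Psi F F0 z = I z" if "z \<in> {\<mu>0..y}" for z
  proof -
    have "AE u in lborel. u \<noteq> z" by (rule AE_lborel_singleton)
    then show ?thesis
      unfolding Psi_def I_def set_lebesgue_integral_def
      by (intro integral_cong_AE) (auto split: split_indicator)
  qed
  have "{\<mu>0..<y} = {\<mu>0..<x} \<union> {x..<y}" using assms by auto
  then have "I y = I x + (LBINT u:{x..<y}. 1 / phi F u)"
    unfolding I_def
    by (subst \<open>{\<mu>0..<y} = _\<close>, subst set_integral_Un)
       (use assms in \<open>auto intro!: set_integrable_subset[OF int]\<close>)
  then have "Psi F F0 y - Psi F F0 x = (LBINT u:{x..<y}. 1 / phi F u)"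
    using Psi_I assms by auto
  moreover have "set_integrable lborel {x..<y} (\<lambda>u. 1 / phi F u)"
    by (rule set_integrable_subset[OF int]) (use assms in auto)
  moreover have "1 / phi F x \<le> 1 / phi F u" "1 / phi F u \<le> 1 / phi F y" if "u \<in> {x..<y}" for u
    using that phi_pos_downward[OF assms(3)] assms by (auto intro!: divide_left_mono phi_antimono mult_pos_pos)
  ultimately show "(y - x) / phi F x \<le> Psi F F0 y - Psi F F0 x" "Psi F F0 y - Psi F F0 x \<le> (y - x) / phi F y"
    using set_integral_constant_bounds[of x y "\<lambda>u. 1 / phi F u" "1 / phi F x" "1 / phi F y"] assms by auto
qed

lemma Psi_start: "Psi F F0 \<mu>0 = 0"
  unfolding Psi_def by (simp add: set_integral_singleton)

lemma Psi_strict_mono: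
  assumes "\<mu>0 \<le> x" "x < y" "0 < phi F y"
  shows "Psi F F0 x < Psi F F0 y"
proof -
  have "0 < (y - x) / phi F x" using phi_pos_downward[OF assms(3), of x] assms by simp
  with Psi_diff_bounds(1)[of x y] assms show ?thesis by simp
qed

text \<open>
  The argument covers finite and infinite upper end points at once: as \<open>\<phi>\<close> is 1-Lipschitz, moving
  from \<open>x\<close> to \<open>x + \<phi> x / 2\<close> stays inside the domain, and as \<open>1 / \<phi>\<close> is nondecreasing, this adds at
  least \<open>1 / 2\<close> to \<open>\<Psi>\<close>.
\<close>

lemma Psi_unbounded: "\<exists>x\<ge>\<mu>0. 0 < phi F x \<and> real n / 2 \<le> Psi F F0 x"
proof (induction n)
  case 0
  then show ?case using start Psi_start by (auto simp: phi_pos_iff)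
next
  case (Suc n)
  then obtain x where x: "\<mu>0 \<le> x" "0 < phi F x" "real n / 2 \<le> Psi F F0 x" by blast
  define y where "y = x + phi F x / 2"
  have "phi F x - phi F y \<le> phi F x / 2"
    using phi_lipschitz[of x y] x unfolding y_def by linarith
  then have y: "0 < phi F y" using x by simp
  have "(y - x) / phi F x \<le> Psi F F0 y - Psi F F0 x"
    using x y by (intro Psi_diff_bounds) (auto simp: y_def)
  then have "real (Suc n) / 2 \<le> Psi F F0 y"
    using x by (simp add: y_def)
  moreover have "\<mu>0 \<le> y" using x by (simp add: y_def)
  ultimately show ?case using y by blast
qed

lemma Psi_bij_betw: "bij_betw (Psi F F0) {x. \<mu>0 \<le> x \<and> ereal x < upper_end F} {0..}"
  unfolding bij_betw_def
proof
  show "inj_on (Psi F F0) {x. \<mu>0 \<le> x \<and> ereal x < upper_end F}"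
    by (rule linorder_inj_onI) (auto simp flip: phi_pos_iff dest: Psi_strict_mono)
  show "Psi F F0 ` {x. \<mu>0 \<le> x \<and> ereal x < upper_end F} = {0..}"
  proof (intro equalityI subsetI)
    fix v assume "v \<in> Psi F F0 ` {x. \<mu>0 \<le> x \<and> ereal x < upper_end F}"
    then obtain x where "v = Psi F F0 x" "\<mu>0 \<le> x" "ereal x < upper_end F" by blast
    then show "v \<in> {0..}"
      using Psi_strict_mono[of \<mu>0 x] Psi_start by (cases "x = \<mu>0") (auto simp: phi_pos_iff)
  next
    fix v :: real assume "v \<in> {0..}"
    then have "v \<ge> 0" by simp
    obtain n :: nat where "2 * v \<le> real n" using real_arch_simple by blast
    then obtain x where x: "\<mu>0 \<le> x" "0 < phi F x" "v \<le> Psi F F0 x"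
      using Psi_unbounded[of n] by auto
    have "continuous_on {\<mu>0..x} (Psi F F0)"
    proof (rule lipschitz_on_continuous_on[OF lipschitz_onI])
      have *: "\<bar>Psi F F0 b - Psi F F0 a\<bar> \<le> (b - a) / phi F x" if "\<mu>0 \<le> a" "a \<le> b" "b \<le> x" for a b
      proof -
        have b: "0 < phi F b" "0 < phi F a" using phi_pos_downward[OF x(2)] that by auto
        have "(b - a) / phi F b \<le> (b - a) / phi F x"
          using that x b by (intro divide_left_mono phi_antimono) auto
        moreover have "0 \<le> (b - a) / phi F a" using that b by simp
        ultimately show ?thesis using Psi_diff_bounds[OF that(1,2) b(1)] by linarith
      qed
      fix a b assume "a \<in> {\<mu>0..x}" "b \<in> {\<mu>0..x}"
      then show "dist (Psi F F0 a) (Psi F F0 b) \<le> 1 / phi F x * dist a b"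
        using *[of a b] *[of b a] by (cases "a \<le> b") (auto simp: dist_real_def)
    qed (use x in simp)
    from IVT'[of "Psi F F0", OF _ x(3,1) this] obtain z where "\<mu>0 \<le> z" "z \<le> x" "Psi F F0 z = v"
      using \<open>v \<ge> 0\<close> by (auto simp: Psi_start)
    moreover have "ereal z < upper_end F"
      using phi_pos_downward[OF x(2)] \<open>z \<le> x\<close> by (simp flip: phi_pos_iff)
    ultimately show "v \<in> Psi F F0 ` {x. \<mu>0 \<le> x \<and> ereal x < upper_end F}" by blast
  qed
qed

lemma policy:
  assumes "0 \<le> t"
  shows policy_ge: "\<mu>0 \<le> \<mu> t" and phi_policy_pos: "0 < phi F (\<mu> t)"
    and Psi_policy: "Psi F F0 (\<mu> t) = lam * t"
proof -
  have "lam * t \<in> {0..}" using assms lam_pos by simp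
  with the_inv_into_into[OF bij_betw_imp_inj_on[OF Psi_bij_betw], of "lam * t"]
  have "\<mu> t \<in> {x. \<mu>0 \<le> x \<and> ereal x < upper_end F}"
    unfolding opt_policy_def using bij_betw_imp_surj_on[OF Psi_bij_betw] by blast
  then show "\<mu>0 \<le> \<mu> t" "0 < phi F (\<mu> t)" by (auto simp: phi_pos_iff)
  show "Psi F F0 (\<mu> t) = lam * t"
    unfolding opt_policy_def by (rule f_the_inv_into_f_bij_betw[OF Psi_bij_betw]) (use \<open>lam * t \<in> {0..}\<close> in simp)
qed

lemma policy_strict_mono:
  assumes "0 \<le> s" "s < t"
  shows "\<mu> s < \<mu> t"
proof (rule ccontr)
  assume "\<not> \<mu> s < \<mu> t"
  then have "Psi F F0 (\<mu> t) \<le> Psi F F0 (\<mu> s)"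
    using Psi_strict_mono[of "\<mu> t" "\<mu> s"] policy[of s] policy[of t] assms by (cases "\<mu> s = \<mu> t") auto
  then show False using Psi_policy[of s] Psi_policy[of t] assms lam_pos by simp
qed

lemma policy_mono: "0 \<le> s \<Longrightarrow> s \<le> t \<Longrightarrow> \<mu> s \<le> \<mu> t"
  using policy_strict_mono[of s t] by (cases "s = t") auto

text \<open>
  The rate at which the policy changes, that is, its derivative.
\<close>

abbreviation "speed t \<equiv> lam * phi F (\<mu> t)"

text \<open>
  The bounds on increments of \<open>\<Psi>\<close>, read for the inverse function.
\<close>

lemma policy_diff_bounds:
  assumes "0 \<le> s" "s \<le> t"
  shows "(t - s) * speed t \<le> \<mu> t - \<mu> s" "\<mu> t - \<mu> s \<le> (t - s) * speed s"
  using Psi_diff_bounds[OF policy_ge policy_mono phi_policy_pos, of s t] Psi_policy[of s] Psi_policy[of t]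
    phi_policy_pos[of s] phi_policy_pos[of t] assms
  by (simp_all add: field_simps)

lemma speed_pos: "0 \<le> t \<Longrightarrow> 0 < speed t"
  using phi_policy_pos lam_pos by simp

lemma speed_antimono: "0 \<le> s \<Longrightarrow> s \<le> t \<Longrightarrow> speed t \<le> speed s"
  using lam_pos by (intro mult_left_mono phi_antimono policy_mono) auto

lemma policy_lipschitz: "(speed 0)-lipschitz_on {0..} \<mu>"
proof (rule lipschitz_onI)
  have *: "\<bar>\<mu> b - \<mu> a\<bar> \<le> speed 0 * (b - a)" if "0 \<le> a" "a \<le> b" for a b
  proof -
    have "(b - a) * speed a \<le> (b - a) * speed 0"
      by (rule mult_left_mono[OF speed_antimono]) (use that in auto)
    then show ?thesis
      using policy_diff_bounds(2)[OF that] policy_mono[OF that] by (simp add: mult.commute)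
  qed
  fix a b :: real assume "a \<in> {0..}" "b \<in> {0..}"
  then show "dist (\<mu> a) (\<mu> b) \<le> speed 0 * dist a b"
    using *[of a b] *[of b a] by (cases "a \<le> b") (auto simp: dist_real_def)
qed (use speed_pos[of 0] in simp)

lemma policy_continuous: "continuous_on {0..} \<mu>"
  by (rule lipschitz_on_continuous_on[OF policy_lipschitz])

lemma speed_lipschitz: "(lam * speed 0)-lipschitz_on {0..} (\<lambda>t. speed t)"
proof (rule lipschitz_onI)
  fix s t :: real assume "s \<in> {0..}" "t \<in> {0..}"
  have "dist (speed s) (speed t) = lam * \<bar>phi F (\<mu> s) - phi F (\<mu> t)\<bar>"
    using lam_pos by (simp add: dist_real_def abs_mult flip: right_diff_distrib)
  also have "\<dots> \<le> lam * dist (\<mu> s) (\<mu> t)"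
    using lam_pos phi_lipschitz by (intro mult_left_mono) (auto simp: dist_real_def)
  also have "\<dots> \<le> lam * (speed 0 * dist s t)"
    using lam_pos lipschitz_onD[OF policy_lipschitz \<open>s \<in> {0..}\<close> \<open>t \<in> {0..}\<close>] by (intro mult_left_mono) auto
  finally show "dist (speed s) (speed t) \<le> lam * speed 0 * dist s t" by (simp only: mult.assoc)
qed (use speed_pos[of 0] lam_pos in simp)

lemma speed_continuous: "continuous_on {0..} (\<lambda>t. speed t)"
  by (rule lipschitz_on_continuous_on[OF speed_lipschitz])

lemma policy_has_derivative:
  assumes "0 \<le> t"
  shows "(\<mu> has_real_derivative speed t) (at t within {0..})"
  using assms speed_continuous policy_diff_bounds
  by (intro squeezed_increments_imp_deriv[where a = "\<lambda>t. speed t"]) (auto simp: continuous_on_eq_continuous_within)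

lemma policy_deriv_eq:
  assumes "0 \<le> t"
  shows "opt_policy_deriv lam F F0 t = speed t"
proof -
  have "at_right t \<le> at t within {0..}"
    using assms by (intro at_le) auto
  then have "at t within {0..} \<noteq> bot"
    using trivial_limit_at_right_real[of t] bot_unique by metis
  then show ?thesis
    unfolding opt_policy_deriv_def
    using policy_has_derivative[OF assms]
    by (intro vector_derivative_within) (auto simp: has_real_derivative_iff_has_vector_derivative)
qed

text \<open>
  Off the atoms of \<open>F\<close> this is the chain rule; there the acceptance probability
  \<open>P(X \<ge> \<mu>(t))\<close> and the tail \<open>1 - F (\<mu> t)\<close> agree.
\<close>

lemma speed_has_derivative:
  assumes t: "0 < t" and cont: "isCont F (\<mu> t)"
  shows "((\<lambda>t. speed t) has_real_derivative - (lam * prob {\<mu> t..} * speed t)) (at t)"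
proof -
  have "prob ({\<mu> t} \<union> {\<mu> t<..}) = prob {\<mu> t} + prob {\<mu> t<..}"
    by (rule finite_measure_Union) auto
  moreover have "{\<mu> t} \<union> {\<mu> t<..} = {\<mu> t..}" by auto
  moreover have "prob {\<mu> t} = 0" using cont by (simp add: F_eq isCont_cdf)
  ultimately have prob_eq: "prob {\<mu> t..} = 1 - F (\<mu> t)" by (simp add: survival_eq)
  have "at t within {0..} = at t" using t by (intro at_within_interior) simp
  then have "(\<mu> has_real_derivative speed t) (at t)"
    using policy_has_derivative[of t] t by simp
  from DERIV_cmult[OF DERIV_chain2[OF phi_has_derivative[OF cont] this], of lam]
  show ?thesis by (rule DERIV_cong) (simp add: prob_eq algebra_simps)
qed

end

section \<open>A fundamental theorem of calculus for Lipschitz functions\<close>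

lemma forward_quotient_tendsto:
  fixes f :: "real \<Rightarrow> real"
  assumes "(f has_real_derivative D) (at x)"
  shows "(\<lambda>n. (f (x + 1 / real (Suc n)) - f x) / (1 / real (Suc n))) \<longlonglongrightarrow> D"
proof -
  have "(\<lambda>n. 1 / real (Suc n)) \<longlonglongrightarrow> 0" by (rule LIMSEQ_Suc[OF lim_1_over_n])
  then have "filterlim (\<lambda>n. 1 / real (Suc n)) (at 0) sequentially"
    by (auto simp: filterlim_at)
  from filterlim_compose[OF _ this, of "\<lambda>h. (f (x + h) - f x) / h"] assms
  show ?thesis by (simp add: DERIV_def)
qed

text \<open>
  For Lipschitz functions the fundamental theorem tolerates countably many exceptional points. The
  difference quotients are bounded by the Lipschitz constant and converge to the derivative off a null
  set, so that their integrals converge; these integrals are difference quotients of an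
  antiderivative of \<open>f\<close> at the two end points and tend to \<open>f b - f a\<close>.
\<close>

lemma fundamental_theorem_of_calculus_lipschitz:
  fixes f h :: "real \<Rightarrow> real"
  assumes ab: "a \<le> b" and lip: "L-lipschitz_on {a..b} f" and C: "countable C"
    and deriv: "\<And>x. x \<in> {a<..<b} - C \<Longrightarrow> (f has_real_derivative h x) (at x)"
  shows "(h has_integral f b - f a) {a..b}"
proof -
  define c where "c x = max a (min b x)" for x
  define F where "F x = f (c x)" for x
  define \<delta> where "\<delta> n = 1 / real (Suc n)" for n
  have \<delta>: "0 < \<delta> n" "\<delta> n \<le> 1" for n by (auto simp: \<delta>_def)
  have lipF: "L-lipschitz_on UNIV F"
  proof (rule lipschitz_onI)
    fix x y :: real
    have "dist (F x) (F y) \<le> L * dist (c x) (c y)"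
      unfolding F_def using ab by (intro lipschitz_onD[OF lip]) (auto simp: c_def)
    also have "\<dots> \<le> L * dist x y"
      using lipschitz_on_nonneg[OF lip] by (intro mult_left_mono) (auto simp: c_def dist_real_def)
    finally show "dist (F x) (F y) \<le> L * dist x y" .
  qed (rule lipschitz_on_nonneg[OF lip])
  have contF: "continuous_on A F" for A
    using lipschitz_on_continuous_on[OF lipF] continuous_on_subset by blast
  \<comment> \<open>Steps of length at most one stay in \<open>{a..b + 1}\<close>, which has to lie in the interior.\<close>
  obtain P where P: "\<And>x. x \<in> {a - 1..b + 2} \<Longrightarrow> (P has_vector_derivative F x) (at x within {a - 1..b + 2})"
    using antiderivative_continuous[OF contF] by blast
  have P': "(P has_real_derivative F x) (at x)" if "a \<le> x" "x \<le> b + 1" for x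
    using P[of x] that at_within_interior[of x "{a - 1..b + 2}"]
    by (auto simp: has_real_derivative_iff_has_vector_derivative)
  define q where "q n x = (F (x + \<delta> n) - F x) / \<delta> n" for n x
  let ?N = "insert a (insert b C)"
  \<comment> \<open>Off the null set of exceptional points the quotients converge; on it they are set to zero.\<close>
  define q' where "q' n x = (if x \<in> ?N then 0 else q n x)" for n x
  define h' where "h' x = (if x \<in> ?N then 0 else h x)" for x
  have "negligible (\<Union>((\<lambda>x. {x}) ` ?N))"
    using C by (intro negligible_countable_Union) auto
  then have neg: "negligible ?N" by simp
  have q_int: "(q' n has_integral ((P (b + \<delta> n) - P b) / \<delta> n - (P (a + \<delta> n) - P a) / \<delta> n)) {a..b}" for n
  proof -
    have "((\<lambda>x. (P (x + \<delta> n) - P x) / \<delta> n) has_real_derivative q n x) (at x within {a..b})"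
      if "x \<in> {a..b}" for x
    proof -
      have "((\<lambda>x. P (x + \<delta> n)) has_real_derivative F (x + \<delta> n)) (at x)"
        using P'[of "x + \<delta> n"] that \<delta>[of n] by (simp add: DERIV_shift)
      with P'[of x] that have "((\<lambda>x. (P (x + \<delta> n) - P x) / \<delta> n) has_real_derivative q n x) (at x)"
        unfolding q_def by (intro DERIV_cdivide DERIV_diff) auto
      then show ?thesis by (rule has_field_derivative_at_within)
    qed
    then have "(q n has_integral ((P (b + \<delta> n) - P b) / \<delta> n - (P (a + \<delta> n) - P a) / \<delta> n)) {a..b}"
      using ab by (intro fundamental_theorem_of_calculus)
                  (auto simp: has_real_derivative_iff_has_vector_derivative)
    then show ?thesis
      by (rule has_integral_spike[OF neg, rotated]) (simp add: q'_def)
  qed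
  have bound: "norm (q' n x) \<le> L" for n x
  proof -
    have "\<bar>F (x + \<delta> n) - F x\<bar> \<le> L * \<delta> n"
      using lipschitz_onD[OF lipF, of "x + \<delta> n" x] \<delta>[of n] by (simp add: dist_real_def)
    then show ?thesis
      using \<delta>[of n] lipschitz_on_nonneg[OF lip] by (simp add: q'_def q_def field_simps)
  qed
  have conv: "(\<lambda>n. q' n x) \<longlonglongrightarrow> h' x" if "x \<in> {a..b}" for x
  proof (cases "x \<in> ?N")
    case False
    then have x: "x \<in> {a<..<b} - C" using that by auto
    have "(F has_real_derivative h x) (at x)"
    proof (rule has_field_derivative_transform_within_open[OF deriv[OF x]])
      show "open {a<..<b}" "x \<in> {a<..<b}" using x by auto
    qed (simp add: F_def c_def)
    from forward_quotient_tendsto[OF this] False show ?thesis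
      by (simp add: q'_def h'_def q_def \<delta>_def)
  qed (simp add: q'_def h'_def)
  have dom: "h' integrable_on {a..b}" "(\<lambda>n. integral {a..b} (q' n)) \<longlonglongrightarrow> integral {a..b} h'"
    using dominated_convergence[of q' "{a..b}" "\<lambda>_. L" h'] q_int bound conv
    by (auto simp: has_integral_integrable)
  have "(\<lambda>n. (P (b + \<delta> n) - P b) / \<delta> n - (P (a + \<delta> n) - P a) / \<delta> n) \<longlonglongrightarrow> F b - F a"
    unfolding \<delta>_def using ab by (intro tendsto_diff forward_quotient_tendsto P') auto
  then have "(\<lambda>n. integral {a..b} (q' n)) \<longlonglongrightarrow> F b - F a"
    by (simp only: integral_unique[OF q_int])
  then have "integral {a..b} h' = F b - F a"
    by (rule LIMSEQ_unique[OF dom(2)])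
  then have "(h' has_integral f b - f a) {a..b}"
    using dom(1) ab by (simp add: has_integral_integrable_integral F_def c_def)
  then show ?thesis
    by (rule has_integral_spike[OF neg, rotated]) (simp add: h'_def)
qed

lemma lipschitz_on_mult_bounded:
  fixes f g :: "real \<Rightarrow> real"
  assumes f: "A-lipschitz_on S f" and g: "B-lipschitz_on S g"
    and f_bound: "\<And>x. x \<in> S \<Longrightarrow> \<bar>f x\<bar> \<le> a" and g_bound: "\<And>x. x \<in> S \<Longrightarrow> \<bar>g x\<bar> \<le> b"
    and nonneg: "0 \<le> a" "0 \<le> b"
  shows "(a * B + b * A)-lipschitz_on S (\<lambda>x. f x * g x)"
proof (rule lipschitz_onI)
  fix x y assume xy: "x \<in> S" "y \<in> S"
  have "\<bar>f x * g x - f y * g y\<bar> = \<bar>f x * (g x - g y) + g y * (f x - f y)\<bar>"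
    by (simp add: algebra_simps)
  also have "\<dots> \<le> \<bar>f x\<bar> * \<bar>g x - g y\<bar> + \<bar>g y\<bar> * \<bar>f x - f y\<bar>"
    by (rule order_trans[OF abs_triangle_ineq]) (simp add: abs_mult)
  also have "\<dots> \<le> a * (B * \<bar>x - y\<bar>) + b * (A * \<bar>x - y\<bar>)"
    using f_bound[of x] g_bound[of y] lipschitz_onD[OF f xy] lipschitz_onD[OF g xy] xy nonneg
    by (intro add_mono mult_mono) (auto simp: dist_real_def)
  finally show "dist (f x * g x) (f y * g y) \<le> (a * B + b * A) * dist x y"
    by (simp add: dist_real_def algebra_simps)
qed (use nonneg lipschitz_on_nonneg[OF f] lipschitz_on_nonneg[OF g] in simp)

lemma exp_decay_lipschitz:
  assumes "0 \<le> l"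
  shows "l-lipschitz_on {0..} (\<lambda>x::real. exp (- l * x))"
proof (rule lipschitz_onI)
  have *: "\<bar>exp (- l * x) - exp (- l * y)\<bar> \<le> l * (y - x)" if "0 \<le> x" "x \<le> y" for x y
  proof -
    have "exp (- l * x) - exp (- l * y) = exp (- l * x) * (1 - exp (- l * (y - x)))"
      by (simp add: algebra_simps flip: exp_add)
    also have "\<dots> \<le> 1 * (1 - exp (- l * (y - x)))"
      using that assms by (intro mult_right_mono) auto
    also have "\<dots> \<le> l * (y - x)"
      using exp_ge_add_one_self[of "- l * (y - x)"] by simp
    finally show ?thesis using that assms by (simp add: mult_left_mono)
  qed
  fix x y :: real assume "x \<in> {0..}" "y \<in> {0..}"
  then show "dist (exp (- l * x)) (exp (- l * y)) \<le> l * dist x y"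
    using *[of x y] *[of y x] by (cases "x \<le> y") (auto simp: dist_real_def)
qed fact

section \<open>The renewal identity of the bidding process\<close>

lemma time_remaining_cong:
  assumes "\<And>i. 1 \<le> i \<Longrightarrow> i \<le> n \<Longrightarrow> d i = d' i"
  shows "time_remaining d t n = time_remaining d' t n"
  using assms by (induction n) auto

lemma time_remaining_measurable:
  assumes "\<And>i. 1 \<le> i \<Longrightarrow> i \<le> n \<Longrightarrow> (\<lambda>\<omega>. d i \<omega>) \<in> borel_measurable M"
  shows "(\<lambda>\<omega>. time_remaining (\<lambda>i. d i \<omega>) t n) \<in> borel_measurable M"
  using assms by (induction n) (auto intro!: borel_measurable_max)

lemma time_remaining_nonneg: "0 \<le> t \<Longrightarrow> 0 \<le> time_remaining d t n"
  by (induction n) auto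

lemma time_remaining_antimono:
  assumes "\<And>i. 1 \<le> i \<Longrightarrow> 0 \<le> d i" "0 \<le> t" "m \<le> n"
  shows "time_remaining d t n \<le> time_remaining d t m"
  using \<open>m \<le> n\<close>
proof (induction rule: dec_induct)
  case (step n)
  have "time_remaining d t (Suc n) \<le> time_remaining d t n"
    using assms(1)[of "Suc n"] time_remaining_nonneg[OF assms(2), of d n] by simp
  with step show ?case by linarith
qed simp

text \<open>
  The bidding process is studied for an arbitrary continuous policy \<open>\<mu>\<close> together with a positive,
  nonincreasing Lipschitz solution \<open>g\<close> of \<open>g' = - \<lambda> P(X \<ge> \<mu>) g\<close>, valid off a countable set \<open>C\<close>. Under the optimal
  policy, \<open>g\<close> is the derivative of \<open>\<mu>\<close> and \<open>C\<close> is the set of times at which \<open>\<mu>\<close> passes an atom of \<open>F\<close>.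
\<close>

locale bidding_process = prob_space \<Omega>
  for \<Omega> :: "'w measure" +
  fixes lam :: real and \<mu> g :: "real \<Rightarrow> real" and N :: "real measure"
    and D X :: "nat \<Rightarrow> 'w \<Rightarrow> real" and L :: real and C :: "real set"
  assumes lam_pos: "0 < lam"
    and indep: "indep_vars (\<lambda>_. borel) (case_sum D X) ({1..} <+> {1..})"
    and D: "\<And>i. 1 \<le> i \<Longrightarrow> distributed \<Omega> lborel (D i) (exponential_density lam)"
    and X: "\<And>i. 1 \<le> i \<Longrightarrow> distr \<Omega> borel (X i) = N"
    and \<mu>_cont: "continuous_on {0..} \<mu>"
    and g_lipschitz: "L-lipschitz_on {0..} g"
    and g_pos: "\<And>u. 0 \<le> u \<Longrightarrow> 0 < g u"
    and g_antimono: "\<And>u v. 0 \<le> u \<Longrightarrow> u \<le> v \<Longrightarrow> g v \<le> g u"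
    and C: "countable C"
    and g_deriv: "\<And>u. 0 < u \<Longrightarrow> u \<notin> C \<Longrightarrow>
      (g has_real_derivative - (lam * measure N {\<mu> u..} * g u)) (at u)"
begin

lemma X_measurable: "1 \<le> i \<Longrightarrow> X i \<in> borel_measurable \<Omega>"
  using indep by (auto simp: indep_vars_def dest: bspec[where x="Inr i"])

lemma D_measurable: "1 \<le> i \<Longrightarrow> D i \<in> borel_measurable \<Omega>"
  using indep by (auto simp: indep_vars_def dest: bspec[where x="Inl i"])

lemma N_prob: "prob_space N"
  using prob_space_distr[OF X_measurable[of 1]] X[of 1] by simp

lemma N_sets [simp, measurable_cong]: "sets N = sets borel"
  using X[of 1, symmetric] by simp

lemma N_space [simp]: "space N = UNIV"
  using X[of 1, symmetric] by simp

lemma D_distr: "1 \<le> i \<Longrightarrow> distr \<Omega> borel (D i) = density lborel (exponential_density lam)"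
  using distributed_distr_eq_density[OF D] by (metis distr_cong sets_lborel)

text \<open>
  Constant continuations to the negative half line, where \<open>\<mu>\<close> and \<open>g\<close> are unspecified; they make the
  functions Borel measurable on all of \<open>\<real>\<close>.
\<close>

definition "\<mu>_ext u = \<mu> (max u 0)"

definition "g_ext u = g (max u 0)"

lemma \<mu>_ext_measurable [measurable]: "\<mu>_ext \<in> borel_measurable borel"
  unfolding \<mu>_ext_def
  by (intro borel_measurable_continuous_onI continuous_on_compose2[OF \<mu>_cont] continuous_intros) auto

lemma g_ext_measurable [measurable]: "g_ext \<in> borel_measurable borel"
  unfolding g_ext_def
  by (intro borel_measurable_continuous_onI continuous_on_compose2[OF lipschitz_on_continuous_on[OF g_lipschitz]] continuous_intros) auto

lemma tail_measurable [measurable]: "(\<lambda>a. measure N {a..}) \<in> borel_measurable borel"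
proof -
  interpret N: prob_space N by (rule N_prob)
  have "(\<lambda>a. - measure N {a..}) \<in> borel_measurable borel"
    by (intro borel_measurable_mono monoI) (auto intro!: N.finite_measure_mono)
  from borel_measurable_uminus[OF this] show ?thesis by simp
qed

text \<open>
  The probability that a process with remaining time \<open>v\<close> gets down to remaining time \<open>c\<close> without a
  sale; that it is this probability is the content of \<open>prob_never_accepted_before\<close>.
\<close>

definition survival :: "real \<Rightarrow> real \<Rightarrow> real" where
  "survival c v = g_ext (max v c) / g_ext c"

lemma survival_measurable [measurable]: "survival c \<in> borel_measurable borel"
  unfolding survival_def by measurable

lemma survival_bounds:
  assumes "0 \<le> c"
  shows "0 \<le> survival c v" "survival c v \<le> 1"
  using g_pos[of c] g_pos[of "max v c"] g_antimono[of c "max v c"] assms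
  by (simp_all add: survival_def g_ext_def max.absorb1 le_max_iff_disj)

lemma survival_below: "0 \<le> c \<Longrightarrow> v \<le> c \<Longrightarrow> survival c v = 1"
  using g_pos[of c] by (simp add: survival_def g_ext_def max.absorb1 max.absorb2)

text \<open>
  The integrand is the derivative of \<open>- exp (- \<lambda> d) G (v - d)\<close>, where \<open>G\<close> is the survival function:
  differentiating the exponential gives the term with coefficient one, and differentiating \<open>G\<close> gives the
  term with the acceptance probability. The acceptance probability may jump, hence the version of
  the fundamental theorem with exceptional points.
\<close>

lemma renewal_integral:
  assumes c: "0 < c" "c \<le> v"
  shows "((\<lambda>d. lam * exp (- lam * d) * (1 - measure N {\<mu>_ext (v - d)..}) * survival c (v - d))
      has_integral survival c v - exp (- lam * (v - c))) {0..v - c}"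
proof -
  define A where "A d = - exp (- lam * d) * (g (v - d) / g c)" for d
  have lip: "(1 * (1 / g c * L) + 1 * lam)-lipschitz_on {0..v - c} A"
    unfolding A_def
  proof (rule lipschitz_on_mult_bounded)
    show "lam-lipschitz_on {0..v - c} (\<lambda>d. - exp (- lam * d))"
      using exp_decay_lipschitz[of lam] lam_pos lipschitz_on_subset[of lam "{0..}" _ "{0..v - c}"]
      by (intro lipschitz_on_minus) auto
    show "(1 / g c * L)-lipschitz_on {0..v - c} (\<lambda>d. g (v - d) / g c)"
    proof (rule lipschitz_onI)
      fix x y assume "x \<in> {0..v - c}" "y \<in> {0..v - c}"
      then have "dist (g (v - x)) (g (v - y)) \<le> L * dist (v - x) (v - y)"
        using c by (intro lipschitz_onD[OF g_lipschitz]) auto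
      then show "dist (g (v - x) / g c) (g (v - y) / g c) \<le> 1 / g c * L * dist x y"
        using g_pos[of c] c
        by (simp add: dist_real_def divide_right_mono abs_minus_commute flip: diff_divide_distrib)
    qed (use g_pos[of c] c lipschitz_on_nonneg[OF g_lipschitz] in simp)
    show "\<bar>- exp (- lam * d)\<bar> \<le> 1" if "d \<in> {0..v - c}" for d
      using that lam_pos by simp
    show "\<bar>g (v - d) / g c\<bar> \<le> 1" if "d \<in> {0..v - c}" for d
      using that c g_pos[of c] g_pos[of "v - d"] g_antimono[of c "v - d"] by simp
  qed auto
  have "((\<lambda>d. lam * exp (- lam * d) * (1 - measure N {\<mu>_ext (v - d)..}) * survival c (v - d))
      has_integral A (v - c) - A 0) {0..v - c}"
  proof (rule fundamental_theorem_of_calculus_lipschitz[OF _ lip])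
    show "countable ((\<lambda>u. v - u) ` C)" using C by simp
    fix d assume d: "d \<in> {0<..<v - c} - (\<lambda>u. v - u) ` C"
    then have "v - d \<notin> C" by (metis DiffD2 diff_diff_eq2 image_eqI add_diff_cancel_left')
    then have "(g has_real_derivative - (lam * measure N {\<mu> (v - d)..} * g (v - d))) (at (v - d))"
      using d c by (intro g_deriv) auto
    moreover have "((\<lambda>d. v - d) has_real_derivative -1) (at d)"
      by (auto intro!: derivative_eq_intros)
    ultimately have g: "((\<lambda>d. g (v - d)) has_real_derivative lam * measure N {\<mu> (v - d)..} * g (v - d)) (at d)"
      using DERIV_chain2[where f = g and g = "\<lambda>d. v - d" and Db = "-1"] by fastforce
    have eqs: "survival c (v - d) = g (v - d) / g c" "\<mu>_ext (v - d) = \<mu> (v - d)"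
      using d c by (auto simp: survival_def g_ext_def \<mu>_ext_def max.absorb1)
    show "(A has_real_derivative
        lam * exp (- lam * d) * (1 - measure N {\<mu>_ext (v - d)..}) * survival c (v - d)) (at d)"
      unfolding A_def eqs using g_pos[of c] c
      by (auto intro!: derivative_eq_intros g simp: field_simps)
  qed (use c in simp)
  moreover have "A (v - c) - A 0 = survival c v - exp (- lam * (v - c))"
    using c g_pos[of c] by (simp add: A_def survival_def g_ext_def max.absorb1)
  ultimately show ?thesis by simp
qed

text \<open>
  The renewal identity. Either the next offer arrives with at least \<open>c\<close> time left, is rejected and the
  process restarts at \<open>v - d\<close>, or it arrives later than that, which happens with probability
  \<open>exp (- \<lambda> (v - c))\<close> and already counts as survival.
\<close>

lemma one_step:
  assumes c: "0 < c" and v: "0 \<le> v"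
  shows "(\<integral>\<^sup>+ d. \<integral>\<^sup>+ x. ennreal (of_bool (\<not> (c \<le> max (v - d) 0 \<and> \<mu>_ext (max (v - d) 0) \<le> x))
      * survival c (max (v - d) 0)) \<partial>N \<partial>density lborel (exponential_density lam)) = ennreal (survival c v)"
proof -
  interpret N: prob_space N by (rule N_prob)
  define \<kappa> where "\<kappa> u = (if c \<le> u then (1 - measure N {\<mu>_ext u..}) * survival c u else 1)" for u
  have [measurable]: "\<kappa> \<in> borel_measurable borel"
    unfolding \<kappa>_def by measurable
  have \<kappa>_nonneg: "0 \<le> \<kappa> u" for u
    using survival_bounds[of c u] c N.prob_le_1 by (auto simp: \<kappa>_def)
  have inner: "(\<integral>\<^sup>+ x. ennreal (of_bool (\<not> (c \<le> u \<and> \<mu>_ext u \<le> x)) * survival c u) \<partial>N) = ennreal (\<kappa> u)" for u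
  proof (cases "c \<le> u")
    case True
    have "(\<integral>\<^sup>+ x. ennreal (of_bool (\<not> (c \<le> u \<and> \<mu>_ext u \<le> x)) * survival c u) \<partial>N)
        = (\<integral>\<^sup>+ x. ennreal (survival c u) * indicator {..<\<mu>_ext u} x \<partial>N)"
      using True by (intro nn_integral_cong) (auto split: split_indicator)
    also have "\<dots> = ennreal (survival c u * measure N {..<\<mu>_ext u})"
      using survival_bounds[of c u] c by (simp add: nn_integral_cmult_indicator N.emeasure_eq_measure ennreal_mult')
    also have "measure N {..<\<mu>_ext u} = 1 - measure N {\<mu>_ext u..}"
    proof -
      have "space N - {\<mu>_ext u..} = {..<\<mu>_ext u}" by auto
      then show ?thesis using N.prob_compl[of "{\<mu>_ext u..}"] by simp
    qed
    finally show ?thesis using True by (simp add: \<kappa>_def mult.commute)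
  next
    case False
    then show ?thesis using survival_below[of c u] c by (simp add: \<kappa>_def N.emeasure_space_1[simplified])
  qed
  have "(\<integral>\<^sup>+ d. ennreal (\<kappa> (max (v - d) 0)) \<partial>density lborel (exponential_density lam))
      = (\<integral>\<^sup>+ d. ennreal (exponential_density lam d) * ennreal (\<kappa> (max (v - d) 0)) \<partial>lborel)"
    by (subst nn_integral_density) (auto intro!: exponential_density_nonneg lam_pos)
  also have "\<dots> = ennreal (survival c v)"
  proof (cases "c \<le> v")
    case False
    then have "(\<integral>\<^sup>+ d. ennreal (exponential_density lam d) * ennreal (\<kappa> (max (v - d) 0)) \<partial>lborel)
        = (\<integral>\<^sup>+ d. ennreal (exponential_density lam d) \<partial>lborel)"
      using c by (intro nn_integral_cong) (auto simp: exponential_density_def \<kappa>_def)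
    also have "\<dots> = emeasure (density lborel (exponential_density lam)) (space (density lborel (exponential_density lam)))"
      by (subst emeasure_density) auto
    also have "\<dots> = 1"
      by (rule prob_space.emeasure_space_1[OF prob_space_exponential_density[OF lam_pos]])
    finally show ?thesis using False survival_below[of c v] c by simp
  next
    case True
    define k where "k d = lam * exp (- lam * d) * (1 - measure N {\<mu>_ext (v - d)..}) * survival c (v - d)" for d
    have [measurable]: "k \<in> borel_measurable borel"
      unfolding k_def by measurable
    have k_nonneg: "0 \<le> k d" for d
      unfolding k_def using lam_pos survival_bounds[of c] c N.prob_le_1 by simp
    have "AE d in lborel. d \<noteq> v - c" by (rule AE_lborel_singleton)
    then have "AE d in lborel. ennreal (exponential_density lam d) * ennreal (\<kappa> (max (v - d) 0))
        = ennreal (indicator {0..v - c} d * k d) + ennreal (lam * exp (- lam * d)) * indicator {v - c..} d"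
    proof eventually_elim
      case (elim d)
      have "ennreal (exponential_density lam d) * ennreal (\<kappa> (max (v - d) 0))
          = ennreal (exponential_density lam d * \<kappa> (max (v - d) 0))"
        using \<kappa>_nonneg by (simp add: ennreal_mult'')
      then show ?case
        using elim True c lam_pos
        by (auto simp: exponential_density_def \<kappa>_def k_def mult_ac max_def split: split_indicator)
    qed
    then have "(\<integral>\<^sup>+ d. ennreal (exponential_density lam d) * ennreal (\<kappa> (max (v - d) 0)) \<partial>lborel)
        = (\<integral>\<^sup>+ d. ennreal (indicator {0..v - c} d * k d) \<partial>lborel)
          + (\<integral>\<^sup>+ d. ennreal (lam * exp (- lam * d)) * indicator {v - c..} d \<partial>lborel)"
      by (subst nn_integral_add[symmetric]) (auto intro!: nn_integral_cong_AE)
    also have "(\<integral>\<^sup>+ d. ennreal (indicator {0..v - c} d * k d) \<partial>lborel)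
        = ennreal (survival c v - exp (- lam * (v - c)))"
    proof (rule nn_integral_has_integral_lborel)
      have "((\<lambda>d. if d \<in> {0..v - c} then k d else 0) has_integral survival c v - exp (- lam * (v - c))) UNIV"
        using renewal_integral[OF c True] by (subst has_integral_restrict_UNIV) (simp add: k_def[abs_def])
      then show "((\<lambda>d. indicator {0..v - c} d * k d) has_integral survival c v - exp (- lam * (v - c))) UNIV"
        by (rule has_integral_eq[rotated]) auto
    qed (auto simp: k_nonneg)
    also have "(\<integral>\<^sup>+ d. ennreal (lam * exp (- lam * d)) * indicator {v - c..} d \<partial>lborel)
        = ennreal (0 - (- exp (- lam * (v - c))))"
    proof (rule nn_integral_FTC_atLeast)
      have "filterlim (\<lambda>d. - lam * d) at_bot at_top"
        using lam_pos by (intro filterlim_tendsto_neg_mult_at_bot[OF tendsto_const] filterlim_ident) auto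
      then show "((\<lambda>d. - exp (- lam * d)) \<longlongrightarrow> 0) at_top"
        using tendsto_minus[OF filterlim_compose[OF exp_at_bot]] by fastforce
      show "((\<lambda>d. - exp (- lam * d)) has_real_derivative lam * exp (- lam * x)) (at x)" for x
        by (auto intro!: derivative_eq_intros)
    qed (use lam_pos in auto)
    finally show ?thesis
      using has_integral_nonneg[OF renewal_integral[OF c True]] k_nonneg
      by (subst (asm) ennreal_plus[symmetric]) (auto simp: k_def)
  qed
  finally show ?thesis by (simp only: inner)
qed

section \<open>The distribution of the time to sale\<close>

abbreviation "V t i \<omega> \<equiv> time_remaining (\<lambda>i. D i \<omega>) t i"

definition rejected_until :: "real \<Rightarrow> real \<Rightarrow> nat \<Rightarrow> 'w \<Rightarrow> bool" where
  "rejected_until c t n \<omega> \<longleftrightarrow> (\<forall>i\<in>{1..n}. \<not> (c \<le> V t i \<omega> \<and> \<mu>_ext (V t i \<omega>) \<le> X i \<omega>))"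

lemma V_measurable [measurable]: "(\<lambda>\<omega>. V t i \<omega>) \<in> borel_measurable \<Omega>"
  by (intro time_remaining_measurable D_measurable)

lemma rejected_until_measurable [measurable]: "Measurable.pred \<Omega> (rejected_until c t n)"
proof -
  have "Measurable.pred \<Omega> (\<lambda>\<omega>. \<not> (c \<le> V t i \<omega> \<and> \<mu>_ext (V t i \<omega>) \<le> X i \<omega>))" if "i \<in> {1..n}" for i
  proof -
    have [measurable]: "X i \<in> borel_measurable \<Omega>" using that by (intro X_measurable) simp
    show ?thesis by measurable
  qed
  then show ?thesis
    unfolding rejected_until_def by (rule pred_intros_finite(3)[OF finite_atLeastAtMost])
qed

text \<open>
  Remaining time and rejections up to offer \<open>n\<close> are functions of the first \<open>n\<close> delays and offers alone.
  The indicator is taken real-valued in order to have one measurable space for the pair.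
\<close>

lemma history_indep:
  "indep_var (borel \<Otimes>\<^sub>M borel) (\<lambda>\<omega>. (V t n \<omega>, of_bool (rejected_until c t n \<omega>) :: real))
     (borel \<Otimes>\<^sub>M borel) (\<lambda>\<omega>. (D (Suc n) \<omega>, X (Suc n) \<omega>))"
proof -
  let ?A = "{1..n} <+> {1..n}" and ?B = "{Suc n} <+> {Suc n}"
  let ?M = "\<lambda>J. PiM J (\<lambda>_. borel :: real measure)"
  define hist where "hist f = (time_remaining (\<lambda>i. f (Inl i)) t n,
    of_bool (\<forall>i\<in>{1..n}. \<not> (c \<le> time_remaining (\<lambda>i. f (Inl i)) t i
      \<and> \<mu>_ext (time_remaining (\<lambda>i. f (Inl i)) t i) \<le> f (Inr i))) :: real)" for f :: "nat + nat \<Rightarrow> real"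
  have comp: "(\<lambda>f. f j) \<in> borel_measurable (?M J)" if "j \<in> J" for j and J :: "(nat + nat) set"
    using that by (rule measurable_component_singleton)
  have tr: "(\<lambda>f. time_remaining (\<lambda>i. f (Inl i)) t k) \<in> borel_measurable (?M ?A)" if "k \<le> n" for k
    using that by (intro time_remaining_measurable comp) auto
  have "Measurable.pred (?M ?A) (\<lambda>f. \<not> (c \<le> time_remaining (\<lambda>i. f (Inl i)) t i
      \<and> \<mu>_ext (time_remaining (\<lambda>i. f (Inl i)) t i) \<le> f (Inr i)))" if "i \<in> {1..n}" for i
  proof -
    have "(\<lambda>f. time_remaining (\<lambda>i. f (Inl i)) t i) \<in> borel_measurable (?M ?A)"
      "(\<lambda>f. f (Inr i)) \<in> borel_measurable (?M ?A)"
      using that tr[of i] comp[OF InrI, of i "{1..n}" "{1..n}"] by simp_all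
    note pair = measurable_Pair[OF this]
    have "Measurable.pred (borel \<Otimes>\<^sub>M borel) (\<lambda>p. \<not> (c \<le> fst p \<and> \<mu>_ext (fst p) \<le> snd p))"
      by measurable
    from measurable_compose[OF pair this] show ?thesis by simp
  qed
  then have [measurable]: "Measurable.pred (?M ?A) (\<lambda>f. \<forall>i\<in>{1..n}. \<not> (c \<le> time_remaining (\<lambda>i. f (Inl i)) t i
      \<and> \<mu>_ext (time_remaining (\<lambda>i. f (Inl i)) t i) \<le> f (Inr i)))"
    by (rule pred_intros_finite(3)[OF finite_atLeastAtMost])
  have [measurable]: "(\<lambda>f. time_remaining (\<lambda>i. f (Inl i)) t n) \<in> borel_measurable (?M ?A)"
    by (rule tr) simp
  have hist: "hist \<in> measurable (?M ?A) (borel \<Otimes>\<^sub>M borel)"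
    unfolding hist_def by measurable
  have next_offer: "(\<lambda>f. (f (Inl (Suc n)), f (Inr (Suc n)))) \<in> measurable (?M ?B) (borel \<Otimes>\<^sub>M borel)"
    by (intro measurable_Pair comp) auto
  have "indep_var (?M ?A) (\<lambda>\<omega>. restrict (\<lambda>i. case_sum D X i \<omega>) ?A)
      (?M ?B) (\<lambda>\<omega>. restrict (\<lambda>i. case_sum D X i \<omega>) ?B)"
    by (rule indep_var_restrict[OF indep]) auto
  from indep_var_compose[OF this hist next_offer]
  have "indep_var (borel \<Otimes>\<^sub>M borel) (\<lambda>\<omega>. hist (restrict (\<lambda>i. case_sum D X i \<omega>) ?A))
      (borel \<Otimes>\<^sub>M borel) (\<lambda>\<omega>. (D (Suc n) \<omega>, X (Suc n) \<omega>))"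
    by (simp add: comp_def Plus_def)
  moreover have "hist (restrict (\<lambda>i. case_sum D X i \<omega>) ?A) = (V t n \<omega>, of_bool (rejected_until c t n \<omega>))" for \<omega>
  proof -
    define f where "f = restrict (\<lambda>i. case_sum D X i \<omega>) ?A"
    have "time_remaining (\<lambda>i. f (Inl i)) t k = V t k \<omega>" if "k \<le> n" for k
      using that by (intro time_remaining_cong) (auto simp: f_def)
    moreover have "f (Inr i) = X i \<omega>" if "i \<in> {1..n}" for i
      using that by (auto simp: f_def)
    ultimately have "hist f = (V t n \<omega>, of_bool (rejected_until c t n \<omega>))"
      by (simp add: hist_def rejected_until_def)
    then show ?thesis by (simp add: f_def)
  qed
  ultimately show ?thesis by simp
qed

lemma offer_distr:
  "1 \<le> i \<Longrightarrow> distr \<Omega> (borel \<Otimes>\<^sub>M borel) (\<lambda>\<omega>. (D i \<omega>, X i \<omega>))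
    = density lborel (exponential_density lam) \<Otimes>\<^sub>M N"
proof -
  assume i: "1 \<le> i"
  have "indep_var (PiM {Inl i} (\<lambda>_. borel)) (\<lambda>\<omega>. restrict (\<lambda>i. case_sum D X i \<omega>) {Inl i})
      (PiM {Inr i} (\<lambda>_. borel)) (\<lambda>\<omega>. restrict (\<lambda>i. case_sum D X i \<omega>) {Inr i})"
    using i by (intro indep_var_restrict[OF indep]) auto
  from indep_var_compose[OF this measurable_component_singleton[of "Inl i"] measurable_component_singleton[of "Inr i"]]
  have "indep_var borel (D i) borel (X i)"
    by (simp add: comp_def)
  then show ?thesis
    using indep_var_distribution_eq[of borel "D i" borel "X i"] D_distr[OF i] X[OF i] by simp
qed

text \<open>
  The induction step integrates out the next offer, which is independent of the history, by means of
  the renewal identity.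
\<close>

lemma martingale:
  assumes c: "0 < c" and t: "0 \<le> t"
  shows "(\<integral>\<^sup>+ \<omega>. ennreal (of_bool (rejected_until c t n \<omega>) * survival c (V t n \<omega>)) \<partial>\<Omega>)
    = ennreal (survival c t)"
proof (induction n)
  case 0
  show ?case by (simp add: rejected_until_def emeasure_space_1)
next
  case (Suc n)
  interpret N: prob_space N by (rule N_prob)
  interpret E: prob_space "density lborel (exponential_density lam)"
    by (rule prob_space_exponential_density[OF lam_pos])
  let ?E = "density lborel (exponential_density lam)"
  let ?U = "\<lambda>\<omega>. (V t n \<omega>, of_bool (rejected_until c t n \<omega>) :: real)"
  let ?W = "\<lambda>\<omega>. (D (Suc n) \<omega>, X (Suc n) \<omega>)"
  define next_time :: "(real \<times> real) \<times> (real \<times> real) \<Rightarrow> real"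
    where "next_time p = max (fst (fst p) - fst (snd p)) 0" for p
  define \<Phi> where "\<Phi> p = ennreal (snd (fst p)) *
      ennreal (of_bool (\<not> (c \<le> next_time p \<and> \<mu>_ext (next_time p) \<le> snd (snd p))) * survival c (next_time p))" for p
  have [measurable]: "next_time \<in> borel_measurable ((borel \<Otimes>\<^sub>M borel) \<Otimes>\<^sub>M (borel \<Otimes>\<^sub>M borel))"
    unfolding next_time_def by measurable
  have [measurable]: "\<Phi> \<in> borel_measurable ((borel \<Otimes>\<^sub>M borel) \<Otimes>\<^sub>M (borel \<Otimes>\<^sub>M borel))"
    unfolding \<Phi>_def by measurable
  have [measurable]: "D (Suc n) \<in> borel_measurable \<Omega>" "X (Suc n) \<in> borel_measurable \<Omega>"
    by (auto intro: D_measurable X_measurable)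
  have U [measurable]: "?U \<in> measurable \<Omega> (borel \<Otimes>\<^sub>M borel)" by measurable
  interpret W: prob_space "distr \<Omega> (borel \<Otimes>\<^sub>M borel) ?W"
    by (rule prob_space_distr) measurable
  have step: "(\<integral>\<^sup>+ w. \<Phi> (?U \<omega>, w) \<partial>distr \<Omega> (borel \<Otimes>\<^sub>M borel) ?W)
      = ennreal (of_bool (rejected_until c t n \<omega>) * survival c (V t n \<omega>))" for \<omega>
  proof -
    have "(\<integral>\<^sup>+ w. \<Phi> (?U \<omega>, w) \<partial>distr \<Omega> (borel \<Otimes>\<^sub>M borel) ?W) = (\<integral>\<^sup>+ w. \<Phi> (?U \<omega>, w) \<partial>(?E \<Otimes>\<^sub>M N))"
      by (simp add: offer_distr)
    also have "\<dots> = (\<integral>\<^sup>+ d. \<integral>\<^sup>+ x. \<Phi> (?U \<omega>, (d, x)) \<partial>N \<partial>?E)"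
      by (rule N.nn_integral_fst[symmetric]) measurable
    also have "\<dots> = ennreal (of_bool (rejected_until c t n \<omega>)) * ennreal (survival c (V t n \<omega>))"
      unfolding \<Phi>_def next_time_def one_step[OF c time_remaining_nonneg[OF t], symmetric]
      by (simp add: nn_integral_cmult)
    finally show ?thesis by (simp add: ennreal_mult')
  qed
  have "(\<integral>\<^sup>+ \<omega>. ennreal (of_bool (rejected_until c t (Suc n) \<omega>) * survival c (V t (Suc n) \<omega>)) \<partial>\<Omega>)
      = (\<integral>\<^sup>+ \<omega>. \<Phi> (?U \<omega>, ?W \<omega>) \<partial>\<Omega>)"
  proof (rule nn_integral_cong)
    fix \<omega>
    have "rejected_until c t (Suc n) \<omega> \<longleftrightarrow> rejected_until c t n \<omega> \<and>
        \<not> (c \<le> V t (Suc n) \<omega> \<and> \<mu>_ext (V t (Suc n) \<omega>) \<le> X (Suc n) \<omega>)"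
      by (auto simp: rejected_until_def atLeastAtMostSuc_conv simp del: time_remaining.simps)
    then show "ennreal (of_bool (rejected_until c t (Suc n) \<omega>) * survival c (V t (Suc n) \<omega>)) = \<Phi> (?U \<omega>, ?W \<omega>)"
      by (auto simp: \<Phi>_def next_time_def)
  qed
  also have "\<dots> = (\<integral>\<^sup>+ p. \<Phi> p \<partial>distr \<Omega> ((borel \<Otimes>\<^sub>M borel) \<Otimes>\<^sub>M (borel \<Otimes>\<^sub>M borel)) (\<lambda>\<omega>. (?U \<omega>, ?W \<omega>)))"
    by (subst nn_integral_distr) measurable
  also have "\<dots> = (\<integral>\<^sup>+ p. \<Phi> p \<partial>(distr \<Omega> (borel \<Otimes>\<^sub>M borel) ?U \<Otimes>\<^sub>M distr \<Omega> (borel \<Otimes>\<^sub>M borel) ?W))"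
    using history_indep[of t n c] by (simp add: indep_var_distribution_eq)
  also have "\<dots> = (\<integral>\<^sup>+ u. \<integral>\<^sup>+ w. \<Phi> (u, w) \<partial>distr \<Omega> (borel \<Otimes>\<^sub>M borel) ?W \<partial>distr \<Omega> (borel \<Otimes>\<^sub>M borel) ?U)"
    by (rule W.nn_integral_fst[symmetric]) measurable
  also have "\<dots> = (\<integral>\<^sup>+ \<omega>. \<integral>\<^sup>+ w. \<Phi> (?U \<omega>, w) \<partial>distr \<Omega> (borel \<Otimes>\<^sub>M borel) ?W \<partial>\<Omega>)"
    by (rule nn_integral_distr[OF U]) measurable
  also have "\<dots> = ennreal (survival c t)"
    unfolding step by (rule Suc)
  finally show ?case .
qed

lemma D_nonneg: "AE \<omega> in \<Omega>. \<forall>i\<ge>1. 0 \<le> D i \<omega>"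
proof -
  have "AE \<omega> in \<Omega>. 0 \<le> D i \<omega>" if "1 \<le> i" for i
  proof -
    have "AE x in distr \<Omega> borel (D i). 0 \<le> x"
      unfolding D_distr[OF that] by (subst AE_density) (auto simp: exponential_density_def)
    then show ?thesis by (rule AE_distrD[OF D_measurable[OF that]])
  qed
  then show ?thesis by (simp add: AE_all_countable)
qed

text \<open>
  If time is left after \<open>n\<close> offers, then each of the first \<open>n\<close> delays is at most \<open>t\<close>; this crude bound decays
  geometrically, which is all the limit of the martingale needs.
\<close>

lemma prob_time_left:
  assumes t: "0 < t"
  shows "prob {\<omega> \<in> space \<Omega>. 0 < V t n \<omega>} \<le> (1 - exp (- t * lam)) ^ n"
proof (cases "n = 0")
  case False
  let ?Y = "case_sum D X"
  have "prob {\<omega> \<in> space \<Omega>. 0 < V t n \<omega>} \<le> prob (\<Inter>j\<in>Inl ` {1..n}. ?Y j -` {..t} \<inter> space \<Omega>)"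
  proof (rule finite_measure_mono_AE)
    show "AE \<omega> in \<Omega>. \<omega> \<in> {\<omega> \<in> space \<Omega>. 0 < V t n \<omega>} \<longrightarrow> \<omega> \<in> (\<Inter>j\<in>Inl ` {1..n}. ?Y j -` {..t} \<inter> space \<Omega>)"
      using D_nonneg
    proof eventually_elim
      case (elim \<omega>)
      have "D i \<omega> \<le> t" if "0 < V t n \<omega>" "1 \<le> i" "i \<le> n" for i
      proof -
        obtain k where k: "i = Suc k" using \<open>1 \<le> i\<close> by (cases i) auto
        have "V t n \<omega> \<le> V t (Suc k) \<omega>" "V t k \<omega> \<le> V t 0 \<omega>"
          using elim t that k by (auto intro!: time_remaining_antimono simp del: time_remaining.simps)
        then show ?thesis using that k by simp
      qed
      then show ?case by auto
    qed
    have "?Y j -` {..t} \<inter> space \<Omega> \<in> events" if "j \<in> Inl ` {1..n}" for j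
      using that measurable_sets[OF D_measurable, of _ "{..t}"] by auto
    then show "(\<Inter>j\<in>Inl ` {1..n}. ?Y j -` {..t} \<inter> space \<Omega>) \<in> events"
      using False by (intro sets.finite_INT) auto
  qed
  also have "\<dots> = (\<Prod>j\<in>Inl ` {1..n}. prob (?Y j -` {..t} \<inter> space \<Omega>))"
    using False by (intro indep_varsD[OF indep]) auto
  also have "\<dots> = (\<Prod>i\<in>{1..n}. prob (D i -` {..t} \<inter> space \<Omega>))"
    by (subst prod.reindex) auto
  also have "\<dots> = (\<Prod>i\<in>{1..n}. 1 - exp (- t * lam))"
  proof (rule prod.cong)
    fix i assume "i \<in> {1..n}"
    moreover have "D i -` {..t} \<inter> space \<Omega> = {\<omega> \<in> space \<Omega>. D i \<omega> \<le> t}" by auto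
    ultimately show "prob (D i -` {..t} \<inter> space \<Omega>) = 1 - exp (- t * lam)"
      using exponential_distributedD_le[OF D, of i t] t lam_pos by simp
  qed simp
  finally show ?thesis by simp
qed simp

lemma rejected_forever_eq:
  "{\<omega> \<in> space \<Omega>. \<forall>i\<ge>1. \<not> (c \<le> V t i \<omega> \<and> \<mu>_ext (V t i \<omega>) \<le> X i \<omega>)}
    = (\<Inter>n. {\<omega> \<in> space \<Omega>. rejected_until c t n \<omega>})"
proof -
  have "(\<forall>i\<ge>1. P i) \<longleftrightarrow> (\<forall>n. \<forall>i\<in>{1..n}. P i)" for P :: "nat \<Rightarrow> bool"
    by (meson atLeastAtMost_iff order_refl)
  then show ?thesis by (auto simp: rejected_until_def)
qed

text \<open>
  The martingale and the indicator of survival up to offer \<open>n\<close> differ only while time is left.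
\<close>

lemma prob_never_accepted_before:
  assumes c: "0 < c" and t: "0 < t"
  shows "prob {\<omega> \<in> space \<Omega>. \<forall>i\<ge>1. \<not> (c \<le> V t i \<omega> \<and> \<mu>_ext (V t i \<omega>) \<le> X i \<omega>)} = survival c t"
proof -
  let ?B = "\<lambda>n. {\<omega> \<in> space \<Omega>. rejected_until c t n \<omega>}"
  have "(\<lambda>n. prob (?B n)) \<longlonglongrightarrow> survival c t"
  proof (rule tendsto_sandwich)
    show "\<forall>\<^sub>F n in sequentially. survival c t \<le> prob (?B n)"
    proof (intro always_eventually allI)
      fix n
      have "ennreal (survival c t) \<le> (\<integral>\<^sup>+ \<omega>. indicator (?B n) \<omega> \<partial>\<Omega>)"
        unfolding martingale[OF c less_imp_le[OF t], of n, symmetric]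
        using survival_bounds[of c] c by (intro nn_integral_mono) (auto split: split_indicator)
      then show "survival c t \<le> prob (?B n)"
        by (simp add: emeasure_eq_measure)
    qed
    show "\<forall>\<^sub>F n in sequentially. prob (?B n) \<le> survival c t + (1 - exp (- t * lam)) ^ n"
    proof (intro always_eventually allI)
      fix n
      let ?Y = "\<lambda>\<omega>. ennreal (of_bool (rejected_until c t n \<omega>) * survival c (V t n \<omega>))"
      let ?T = "{\<omega> \<in> space \<Omega>. 0 < V t n \<omega>}"
      have "ennreal (prob (?B n)) = (\<integral>\<^sup>+ \<omega>. indicator (?B n) \<omega> \<partial>\<Omega>)"
        by (simp add: emeasure_eq_measure)
      also have "\<dots> \<le> (\<integral>\<^sup>+ \<omega>. ?Y \<omega> + indicator ?T \<omega> \<partial>\<Omega>)"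
        using survival_below[of c] c by (intro nn_integral_mono) (auto split: split_indicator)
      also have "\<dots> = ennreal (survival c t) + ennreal (prob ?T)"
        by (subst nn_integral_add) (auto simp: martingale[OF c less_imp_le[OF t]] emeasure_eq_measure)
      also have "\<dots> = ennreal (survival c t + prob ?T)"
        using survival_bounds[of c] c by simp
      finally have "prob (?B n) \<le> survival c t + prob ?T"
        using survival_bounds[of c] c by (subst (asm) ennreal_le_iff) auto
      with prob_time_left[OF t, of n] show "prob (?B n) \<le> survival c t + (1 - exp (- t * lam)) ^ n" by linarith
    qed
    have "(\<lambda>n. (1 - exp (- t * lam)) ^ n) \<longlonglongrightarrow> 0"
      using t lam_pos by (intro LIMSEQ_power_zero) simp
    from tendsto_add[OF tendsto_const this]
    show "(\<lambda>n. survival c t + (1 - exp (- t * lam)) ^ n) \<longlonglongrightarrow> survival c t" by simp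
  qed simp
  moreover have "(\<lambda>n. prob (?B n)) \<longlonglongrightarrow> prob (\<Inter>n. ?B n)"
  proof (rule finite_Lim_measure_decseq)
    show "decseq ?B" by (auto simp: decseq_def rejected_until_def)
  qed auto
  ultimately have "prob (\<Inter>n. ?B n) = survival c t" by (rule LIMSEQ_unique[rotated])
  then show ?thesis by (simp only: rejected_forever_eq)
qed

lemma accepted_eq:
  "0 \<le> t \<Longrightarrow> accepted \<mu> d x t i \<longleftrightarrow> 1 \<le> i \<and> 0 < time_remaining d t i \<and> \<mu>_ext (time_remaining d t i) \<le> x i"
  using time_remaining_nonneg[of t d i] by (simp add: accepted_def \<mu>_ext_def max.absorb1)

lemma sale_time_measurable [measurable]:
  assumes t: "0 \<le> t"
  shows "sale_time \<mu> D X t \<in> borel_measurable \<Omega>"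
proof -
  have [measurable]: "Measurable.pred \<Omega> (\<lambda>\<omega>. accepted \<mu> (\<lambda>i. D i \<omega>) (\<lambda>i. X i \<omega>) t i)" for i
  proof (cases "1 \<le> i")
    case True
    have [measurable]: "X i \<in> borel_measurable \<Omega>" by (rule X_measurable[OF True])
    show ?thesis unfolding accepted_eq[OF t] by measurable
  qed (simp add: accepted_def)
  show ?thesis unfolding sale_time_def Let_def by measurable
qed

lemma sale_time_bounds:
  assumes t: "0 \<le> t"
  shows "sale_time \<mu> D X t \<omega> \<le> t" "AE \<omega> in \<Omega>. 0 \<le> sale_time \<mu> D X t \<omega>"
proof -
  show "sale_time \<mu> D X t \<omega> \<le> t"
    using time_remaining_nonneg[OF t] by (simp add: sale_time_def Let_def)
  show "AE \<omega> in \<Omega>. 0 \<le> sale_time \<mu> D X t \<omega>"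
    using D_nonneg
  proof eventually_elim
    case (elim \<omega>)
    have "V t i \<omega> \<le> t" for i
      using time_remaining_antimono[of "\<lambda>i. D i \<omega>" t 0 i] elim t by simp
    then show ?case using t by (simp add: sale_time_def Let_def)
  qed
qed

text \<open>
  Of all acceptable offers, the first one arrives with the most time left. Hence the sale happens by
  time \<open>s\<close> if and only if some acceptable offer arrives with at least \<open>t - s\<close> time left.
\<close>

theorem prob_sale_time_gt:
  assumes s: "0 \<le> s" "s < t"
  shows "prob {\<omega> \<in> space \<Omega>. s < sale_time \<mu> D X t \<omega>} = g t / g (t - s)"
proof -
  have t: "0 < t" "0 < t - s" using s by auto
  have [measurable]: "sale_time \<mu> D X t \<in> borel_measurable \<Omega>"
    using t by (intro sale_time_measurable) simp
  have "prob {\<omega> \<in> space \<Omega>. s < sale_time \<mu> D X t \<omega>}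
      = prob {\<omega> \<in> space \<Omega>. \<forall>i\<ge>1. \<not> (t - s \<le> V t i \<omega> \<and> \<mu>_ext (V t i \<omega>) \<le> X i \<omega>)}"
  proof (rule finite_measure_eq_AE)
    show "AE \<omega> in \<Omega>. \<omega> \<in> {\<omega> \<in> space \<Omega>. s < sale_time \<mu> D X t \<omega>} \<longleftrightarrow>
        \<omega> \<in> {\<omega> \<in> space \<Omega>. \<forall>i\<ge>1. \<not> (t - s \<le> V t i \<omega> \<and> \<mu>_ext (V t i \<omega>) \<le> X i \<omega>)}"
      using D_nonneg
    proof eventually_elim
      case (elim \<omega>)
      let ?acc = "accepted \<mu> (\<lambda>i. D i \<omega>) (\<lambda>i. X i \<omega>) t"
      have early: "(\<exists>i. ?acc i \<and> t - s \<le> V t i \<omega>) \<longleftrightarrow> \<not> s < sale_time \<mu> D X t \<omega>"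
      proof (cases "\<exists>i. ?acc i")
        case True
        define m where "m = (LEAST i. ?acc i)"
        have m: "?acc m" unfolding m_def using True by (rule LeastI_ex)
        have "V t i \<omega> \<le> V t m \<omega>" if "?acc i" for i
          using elim t Least_le[of ?acc, OF that] by (intro time_remaining_antimono) (auto simp: m_def)
        moreover have "sale_time \<mu> D X t \<omega> = t - V t m \<omega>"
          using True by (simp add: sale_time_def Let_def m_def)
        ultimately show ?thesis using m by fastforce
      next
        case False
        then show ?thesis using s by (auto simp: sale_time_def Let_def)
      qed
      have "(\<exists>i. ?acc i \<and> t - s \<le> V t i \<omega>) \<longleftrightarrow> (\<exists>i\<ge>1. t - s \<le> V t i \<omega> \<and> \<mu>_ext (V t i \<omega>) \<le> X i \<omega>)"
        using t by (auto simp: accepted_eq)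
      with early show ?case by auto
    qed
    show "{\<omega> \<in> space \<Omega>. s < sale_time \<mu> D X t \<omega>} \<in> events" by measurable
    show "{\<omega> \<in> space \<Omega>. \<forall>i\<ge>1. \<not> (t - s \<le> V t i \<omega> \<and> \<mu>_ext (V t i \<omega>) \<le> X i \<omega>)} \<in> events"
      unfolding rejected_forever_eq by measurable
  qed
  also have "\<dots> = g t / g (t - s)"
    using prob_never_accepted_before[OF t(2,1)] s by (simp add: survival_def g_ext_def max.absorb1)
  finally show ?thesis .
qed

end

section \<open>Moments from tail probabilities\<close>

text \<open>
  Write \<open>y ^ Suc k\<close> as the integral of its derivative over \<open>{0..<y}\<close> and exchange the integrals.
\<close>

lemma (in prob_space) expectation_power_layer_cake:
  fixes Y :: "'a \<Rightarrow> real"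
  assumes Y [measurable]: "Y \<in> borel_measurable M" and bounds: "AE \<omega> in M. 0 \<le> Y \<omega>" "AE \<omega> in M. Y \<omega> \<le> 1"
  shows "expectation (\<lambda>\<omega>. Y \<omega> ^ Suc k)
    = (LBINT s:{0..1}. real (Suc k) * s ^ k * prob {\<omega> \<in> space M. s < Y \<omega>})"
proof -
  interpret pair_sigma_finite M lborel ..
  let ?h = "\<lambda>s. real (Suc k) * s ^ k"
  let ?S = "{(\<omega>, s). 0 \<le> s \<and> s < Y \<omega>}"
  have inner: "(\<integral>\<^sup>+ s. ennreal (?h s) * indicator {0..<y} s \<partial>lborel) = ennreal (y ^ Suc k)" if y: "0 \<le> y" for y
  proof -
    have "AE s in lborel. s \<noteq> y" by (rule AE_lborel_singleton)
    then have "(\<integral>\<^sup>+ s. ennreal (?h s) * indicator {0..<y} s \<partial>lborel)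
        = (\<integral>\<^sup>+ s. ennreal (?h s) * indicator {0..y} s \<partial>lborel)"
      by (intro nn_integral_cong_AE) (auto split: split_indicator)
    also have "\<dots> = ennreal (y ^ Suc k - 0 ^ Suc k)"
      using y by (intro nn_integral_FTC_Icc) (auto intro!: DERIV_pow[of "Suc k", simplified])
    finally show ?thesis by simp
  qed
  have S_meas [measurable]: "Measurable.pred (M \<Otimes>\<^sub>M lborel) (\<lambda>p. p \<in> ?S)"
    by (simp add: case_prod_beta)
  have "ennreal (expectation (\<lambda>\<omega>. Y \<omega> ^ Suc k)) = (\<integral>\<^sup>+ \<omega>. ennreal (Y \<omega> ^ Suc k) \<partial>M)"
  proof (rule nn_integral_eq_integral[symmetric])
    show "integrable M (\<lambda>\<omega>. Y \<omega> ^ Suc k)"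
    proof (rule integrable_const_bound[where B = 1])
      show "AE \<omega> in M. norm (Y \<omega> ^ Suc k) \<le> 1"
        using bounds by eventually_elim (simp add: power_le_one mult_le_one)
    qed measurable
    show "AE \<omega> in M. 0 \<le> Y \<omega> ^ Suc k" using bounds by eventually_elim simp
  qed
  also have "\<dots> = (\<integral>\<^sup>+ \<omega>. (\<integral>\<^sup>+ s. ennreal (?h s) * indicator ?S (\<omega>, s) \<partial>lborel) \<partial>M)"
  proof (rule nn_integral_cong_AE)
    show "AE \<omega> in M. ennreal (Y \<omega> ^ Suc k) = (\<integral>\<^sup>+ s. ennreal (?h s) * indicator ?S (\<omega>, s) \<partial>lborel)"
      using bounds
    proof eventually_elim
      case (elim \<omega>)
      have "(\<integral>\<^sup>+ s. ennreal (?h s) * indicator ?S (\<omega>, s) \<partial>lborel) = (\<integral>\<^sup>+ s. ennreal (?h s) * indicator {0..<Y \<omega>} s \<partial>lborel)"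
        by (intro nn_integral_cong) (auto split: split_indicator)
      with inner elim show ?case by simp
    qed
  qed
  also have "\<dots> = (\<integral>\<^sup>+ s. (\<integral>\<^sup>+ \<omega>. ennreal (?h s) * indicator ?S (\<omega>, s) \<partial>M) \<partial>lborel)"
    by (rule Fubini'[symmetric]) measurable
  also have "\<dots> = (\<integral>\<^sup>+ s. ennreal (indicator {0..1} s * (?h s * prob {\<omega> \<in> space M. s < Y \<omega>})) \<partial>lborel)"
  proof (rule nn_integral_cong)
    fix s
    have "(\<integral>\<^sup>+ \<omega>. ennreal (?h s) * indicator ?S (\<omega>, s) \<partial>M)
        = (\<integral>\<^sup>+ \<omega>. (ennreal (?h s) * indicator {0..} s) * indicator {\<omega> \<in> space M. s < Y \<omega>} \<omega> \<partial>M)"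
      by (intro nn_integral_cong) (auto split: split_indicator)
    also have "\<dots> = ennreal (?h s) * indicator {0..} s * emeasure M {\<omega> \<in> space M. s < Y \<omega>}"
      by (rule nn_integral_cmult_indicator) measurable
    also have "\<dots> = ennreal (indicator {0..1} s * (?h s * prob {\<omega> \<in> space M. s < Y \<omega>}))"
    proof (cases "s \<in> {0..1}")
      case True
      then show ?thesis by (simp add: emeasure_eq_measure ennreal_mult')
    next
      case False
      have "prob {\<omega> \<in> space M. s < Y \<omega>} = 0" if "1 < s"
      proof -
        have "AE \<omega> in M. \<omega> \<notin> {\<omega> \<in> space M. s < Y \<omega>}"
          using bounds(2) by eventually_elim (use that in auto)
        then show ?thesis by (subst prob_eq_0) auto
      qed
      then show ?thesis using False by (auto simp: emeasure_eq_measure split: split_indicator)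
    qed
    finally show "(\<integral>\<^sup>+ \<omega>. ennreal (?h s) * indicator ?S (\<omega>, s) \<partial>M)
        = ennreal (indicator {0..1} s * (?h s * prob {\<omega> \<in> space M. s < Y \<omega>}))" .
  qed
  finally have eq: "ennreal (expectation (\<lambda>\<omega>. Y \<omega> ^ Suc k))
      = (\<integral>\<^sup>+ s. ennreal (indicator {0..1} s * (?h s * prob {\<omega> \<in> space M. s < Y \<omega>})) \<partial>lborel)" .
  have [measurable]: "(\<lambda>s. prob {\<omega> \<in> space M. s < Y \<omega>}) \<in> borel_measurable borel"
  proof -
    have "(\<lambda>s. - prob {\<omega> \<in> space M. s < Y \<omega>}) \<in> borel_measurable borel"
      by (intro borel_measurable_mono monoI) (auto intro!: finite_measure_mono)
    from borel_measurable_uminus[OF this] show ?thesis by simp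
  qed
  have "(LBINT s:{0..1}. ?h s * prob {\<omega> \<in> space M. s < Y \<omega>})
      = (LINT s|lborel. indicator {0..1} s * (?h s * prob {\<omega> \<in> space M. s < Y \<omega>}))"
    by (simp add: set_lebesgue_integral_def)
  also have "\<dots> = enn2real (\<integral>\<^sup>+ s. ennreal (indicator {0..1} s * (?h s * prob {\<omega> \<in> space M. s < Y \<omega>})) \<partial>lborel)"
    by (rule integral_eq_nn_integral) (auto split: split_indicator)
  also have "\<dots> = enn2real (ennreal (expectation (\<lambda>\<omega>. Y \<omega> ^ Suc k)))"
    by (simp only: eq)
  also have "\<dots> = expectation (\<lambda>\<omega>. Y \<omega> ^ Suc k)"
  proof (rule enn2real_ennreal)
    show "0 \<le> expectation (\<lambda>\<omega>. Y \<omega> ^ Suc k)"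
      using bounds(1) by (intro integral_nonneg_AE) (auto elim: eventually_mono)
  qed
  finally show ?thesis ..
qed

lemma integral_one_minus_powr:
  assumes "0 \<le> \<gamma>"
  shows "set_integrable lborel {0..1} (\<lambda>s::real. (1 - s) powr \<gamma>)"
    and "(LBINT s:{0..1}. (1 - s) powr \<gamma>) = 1 / (\<gamma> + 1)"
proof -
  show int: "set_integrable lborel {0..1} (\<lambda>s::real. (1 - s) powr \<gamma>)"
    unfolding set_integrable_def
  proof (rule integrableI_bounded_set[where A = "{0..1}" and B = 1])
    show "AE s in lborel. s \<in> {0..1} \<longrightarrow> norm (indicator {0..1} s *\<^sub>R (1 - s) powr \<gamma>) \<le> 1"
      using assms by (auto intro!: AE_I2 powr_le1)
  qed (auto split: split_indicator)
  have "((\<lambda>s. (1 - s) powr \<gamma>) has_integral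
      (- ((1 - 1) powr (\<gamma> + 1) / (\<gamma> + 1)) - - ((1 - 0) powr (\<gamma> + 1) / (\<gamma> + 1)))) {0..1::real}"
  proof (rule fundamental_theorem_of_calculus_interior)
    show "continuous_on {0..1} (\<lambda>s::real. - ((1 - s) powr (\<gamma> + 1) / (\<gamma> + 1)))"
      using assms by (intro continuous_on_minus continuous_on_divide continuous_on_powr' continuous_intros) auto
    fix s :: real assume "s \<in> {0<..<1}"
    then have "((\<lambda>s. (1 - s) powr (\<gamma> + 1)) has_real_derivative
        (\<gamma> + 1) * (1 - s) powr (\<gamma> + 1 - 1) * (- 1)) (at s)"
      by (intro DERIV_chain2[OF has_real_derivative_powr]) (auto intro!: derivative_eq_intros)
    from DERIV_minus[OF DERIV_cdivide[OF this, of "\<gamma> + 1"]]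
    have "((\<lambda>s. - ((1 - s) powr (\<gamma> + 1) / (\<gamma> + 1))) has_real_derivative (1 - s) powr \<gamma>) (at s)"
      using assms by simp
    then show "((\<lambda>s. - ((1 - s) powr (\<gamma> + 1) / (\<gamma> + 1))) has_vector_derivative (1 - s) powr \<gamma>) (at s)"
      by (simp add: has_real_derivative_iff_has_vector_derivative)
  qed simp
  then have "((\<lambda>s. (1 - s) powr \<gamma>) has_integral 1 / (\<gamma> + 1)) {0..1::real}"
    using assms by simp
  then show "(LBINT s:{0..1}. (1 - s) powr \<gamma>) = 1 / (\<gamma> + 1)"
    using set_borel_integral_eq_integral(2)[OF int] by (simp add: integral_unique)
qed

lemma (in prob_space) moment_limit:
  fixes Y :: "real \<Rightarrow> 'a \<Rightarrow> real"
  assumes Y: "\<And>t. Y t \<in> borel_measurable M"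
    and bounds: "\<And>t. AE \<omega> in M. 0 \<le> Y t \<omega>" "\<And>t. AE \<omega> in M. Y t \<omega> \<le> 1"
    and lim: "\<And>s. 0 \<le> s \<Longrightarrow> s < 1 \<Longrightarrow> ((\<lambda>t. prob {\<omega> \<in> space M. s < Y t \<omega>}) \<longlongrightarrow> r s) at_top"
    and r [measurable]: "r \<in> borel_measurable borel"
  shows "((\<lambda>t. expectation (\<lambda>\<omega>. Y t \<omega> ^ Suc k)) \<longlongrightarrow> (LBINT s:{0..1}. real (Suc k) * s ^ k * r s)) at_top"
proof -
  let ?f = "\<lambda>p s. indicator {0..1} s *\<^sub>R (real (Suc k) * s ^ k * p s)"
  let ?p = "\<lambda>t s. prob {\<omega> \<in> space M. s < Y t \<omega>}"
  have "((\<lambda>t. LINT s|lborel. ?f (?p t) s) \<longlongrightarrow> (LINT s|lborel. ?f r s)) at_top"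
  proof (rule integral_dominated_convergence_at_top)
    show "?f (?p t) \<in> borel_measurable lborel" for t
    proof -
      have "(\<lambda>s. - ?p t s) \<in> borel_measurable borel"
        using Y[of t] by (intro borel_measurable_mono monoI) (auto intro!: finite_measure_mono)
      from borel_measurable_uminus[OF this]
      have [measurable]: "?p t \<in> borel_measurable borel" by simp
      show ?thesis by measurable
    qed
    show "?f r \<in> borel_measurable lborel" by measurable
    show "integrable lborel (\<lambda>s::real. indicator {0..1} s *\<^sub>R real (Suc k))"
      by (intro integrableI_bounded_set_indicator[where B = "real (Suc k)"]) auto
    have "norm (?f (?p t) s) \<le> indicator {0..1} s *\<^sub>R real (Suc k)" for t s
    proof (cases "s \<in> {0..1}")
      case True
      then have "real (Suc k) * (s ^ k * ?p t s) \<le> real (Suc k) * 1"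
        by (intro mult_left_mono mult_le_one power_le_one) auto
      with True show ?thesis by (simp add: mult.assoc)
    qed simp
    then show "\<forall>\<^sub>F t in at_top. AE s in lborel. norm (?f (?p t) s) \<le> indicator {0..1} s *\<^sub>R real (Suc k)"
      by simp
    have "AE s in lborel. s \<noteq> (1::real)" by (rule AE_lborel_singleton)
    then show "AE s in lborel. ((\<lambda>t. ?f (?p t) s) \<longlongrightarrow> ?f r s) at_top"
    proof eventually_elim
      case (elim s)
      show ?case
      proof (cases "s \<in> {0..1}")
        case True
        then show ?thesis using elim by (intro tendsto_intros lim) auto
      qed simp
    qed
  qed
  then show ?thesis
    by (simp only: expectation_power_layer_cake[OF Y bounds] set_lebesgue_integral_def)
qed

section \<open>The limiting distribution\<close>

text \<open>
  For \<open>\<gamma> = 0\<close> this is the point mass at \<open>1\<close>: the power \<open>(1 - s) powr 0\<close> equals one for \<open>s < 1\<close>, and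
  the jump at \<open>1\<close> comes from the case distinction.
\<close>

lemma power_law_is_cdf:
  fixes \<gamma> :: real
  assumes \<gamma>: "0 \<le> \<gamma>"
  shows "is_cdf_on_half_line (\<lambda>s. if s < 1 then 1 - (1 - s) powr \<gamma> else 1)"
proof -
  define K where "K s = (if s < 0 then 0 else if s < 1 then 1 - (1 - s) powr \<gamma> else 1)" for s :: real
  have K_mono: "K x \<le> K y" if "x \<le> y" for x y
  proof -
    have "(1 - x) powr \<gamma> \<le> 1" if "0 \<le> x" "x \<le> 1" for x :: real
      using that \<gamma> by (intro powr_le1) auto
    then show ?thesis
      using \<open>x \<le> y\<close> \<gamma> by (auto simp: K_def intro!: powr_mono2)
  qed
  have K_cont: "continuous (at_right a) K" for a
  proof -
    consider "a < 0" | "0 \<le> a" "a < 1" | "1 \<le> a" by linarith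
    then show ?thesis
    proof cases
      case 1
      have "(K \<longlongrightarrow> 0) (at_right a)"
        by (rule Lim_transform_eventually[OF tendsto_const])
           (use 1 eventually_at_right_real[of a 0] in \<open>auto simp: K_def elim!: eventually_mono\<close>)
      with 1 show ?thesis by (simp add: continuous_within K_def)
    next
      case 2
      have "((\<lambda>s. 1 - (1 - s) powr \<gamma>) \<longlongrightarrow> 1 - (1 - a) powr \<gamma>) (at_right a)"
        using 2 by (intro tendsto_intros) auto
      then have "(K \<longlongrightarrow> 1 - (1 - a) powr \<gamma>) (at_right a)"
        by (rule Lim_transform_eventually)
           (use 2 eventually_at_right_real[of a 1] in \<open>auto simp: K_def elim!: eventually_mono\<close>)
      with 2 show ?thesis by (simp add: continuous_within K_def)
    next
      case 3
      have "(K \<longlongrightarrow> 1) (at_right a)"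
        by (rule Lim_transform_eventually[OF tendsto_const])
           (use 3 eventually_at_right_real[of a "a + 1"] in \<open>auto simp: K_def elim!: eventually_mono\<close>)
      with 3 show ?thesis by (simp add: continuous_within K_def)
    qed
  qed
  have K_bot: "(K \<longlongrightarrow> 0) at_bot"
    by (rule Lim_transform_eventually[OF tendsto_const])
       (auto simp: K_def intro: eventually_mono[OF eventually_gt_at_bot[of 0]])
  have K_top: "(K \<longlongrightarrow> 1) at_top"
    by (rule Lim_transform_eventually[OF tendsto_const])
       (auto simp: K_def intro: eventually_mono[OF eventually_ge_at_top[of 1]])
  let ?N = "interval_measure K"
  have N: "real_distribution ?N" "cdf ?N = K"
    using real_distribution_interval_measure[of K] cdf_interval_measure[of K] K_mono K_cont K_bot K_top by blast+
  then interpret N: real_distribution ?N by simp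
  have "measure ?N {..<0} \<le> measure ?N {..0}"
    by (intro N.finite_measure_mono) auto
  also have "\<dots> = K 0" using N(2) by (metis cdf_def)
  finally have "measure ?N {..<0} = 0" by (simp add: K_def measure_le_0_iff)
  then show ?thesis
    unfolding is_cdf_on_half_line_def using N by (intro exI[of _ ?N]) (simp add: K_def)
qed

context bidding_process
begin

lemma scaled_eq: "0 < t \<Longrightarrow> (s < scaled_sale_time \<mu> D X t \<omega>) = (s * t < sale_time \<mu> D X t \<omega>)"
  by (simp add: scaled_sale_time_def pos_less_divide_eq)

lemma scaled_measurable: "0 \<le> t \<Longrightarrow> scaled_sale_time \<mu> D X t \<in> borel_measurable \<Omega>"
  unfolding scaled_sale_time_def by (intro borel_measurable_times borel_measurable_const sale_time_measurable)

lemma scaled_bounds: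
  assumes "0 < t"
  shows "scaled_sale_time \<mu> D X t \<omega> \<le> 1" "AE \<omega> in \<Omega>. 0 \<le> scaled_sale_time \<mu> D X t \<omega>"
  using sale_time_bounds[of t] assms by (auto simp: scaled_sale_time_def)

lemma prob_scaled_gt:
  assumes t: "0 < t" and s: "0 \<le> s" "s < 1"
  shows "prob {\<omega> \<in> space \<Omega>. s < scaled_sale_time \<mu> D X t \<omega>} = g t / g ((1 - s) * t)"
  using prob_sale_time_gt[of "s * t" t] assms by (simp add: scaled_eq algebra_simps)

lemma scaled_cdf_eq:
  assumes t: "0 < t" and s: "0 \<le> s" "s < 1"
  shows "scaled_cdf \<Omega> \<mu> D X t s = 1 - g t / g ((1 - s) * t)"
proof -
  have [measurable]: "scaled_sale_time \<mu> D X t \<in> borel_measurable \<Omega>"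
    using t by (intro scaled_measurable) simp
  have "{\<omega> \<in> space \<Omega>. scaled_sale_time \<mu> D X t \<omega> \<le> s}
      = space \<Omega> - {\<omega> \<in> space \<Omega>. s < scaled_sale_time \<mu> D X t \<omega>}" by auto
  then show ?thesis
    unfolding scaled_cdf_def by (simp add: prob_compl prob_scaled_gt[OF assms])
qed

lemma scaled_cdf_ge_1:
  assumes "0 < t" "1 \<le> s"
  shows "scaled_cdf \<Omega> \<mu> D X t s = 1"
proof -
  have "{\<omega> \<in> space \<Omega>. scaled_sale_time \<mu> D X t \<omega> \<le> s} = space \<Omega>"
    using scaled_bounds(1)[OF assms(1)] assms(2) by (auto intro: order_trans)
  then show ?thesis by (simp add: scaled_cdf_def prob_space)
qed

text \<open>
  The limit vanishes at \<open>0\<close>, because the ratio at \<open>x = 1\<close> is constantly one; being right continuous,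
  it stays below one near \<open>0\<close>, so the limiting ratio cannot vanish near \<open>x = 1\<close>.
\<close>

lemma limiting_distribution_imp_ratio_limit:
  assumes "is_limiting_distribution \<Omega> \<mu> D X H"
  obtains \<gamma> where "0 \<le> \<gamma>" "\<And>x. 0 < x \<Longrightarrow> x \<le> 1 \<Longrightarrow> ((\<lambda>t. g t / g (x * t)) \<longlongrightarrow> x powr \<gamma>) at_top"
proof -
  have H_lim: "((\<lambda>t. scaled_cdf \<Omega> \<mu> D X t s) \<longlongrightarrow> H s) at_top" if "0 \<le> s" for s
    using assms that by (simp add: is_limiting_distribution_def)
  obtain N' where N': "real_distribution N'" "\<And>s. 0 \<le> s \<Longrightarrow> H s = cdf N' s"
    using assms by (auto simp: is_limiting_distribution_def is_cdf_on_half_line_def)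
  define G where "G x = 1 - H (1 - x)" for x
  have G_lim: "((\<lambda>t. g t / g (x * t)) \<longlongrightarrow> G x) at_top" if x: "0 < x" "x \<le> 1" for x
  proof -
    have "((\<lambda>t. 1 - scaled_cdf \<Omega> \<mu> D X t (1 - x)) \<longlongrightarrow> G x) at_top"
      unfolding G_def using x by (intro tendsto_intros H_lim) simp
    then show ?thesis
      by (rule Lim_transform_eventually)
         (use x scaled_cdf_eq[of _ "1 - x"] in \<open>auto intro: eventually_mono[OF eventually_gt_at_top[of 0]]\<close>)
  qed
  have H0: "H 0 = 0"
  proof (rule tendsto_unique[OF _ H_lim[of 0]])
    show "((\<lambda>t. scaled_cdf \<Omega> \<mu> D X t 0) \<longlongrightarrow> 0) at_top"
    proof (rule Lim_transform_eventually[OF tendsto_const])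
      show "\<forall>\<^sub>F t in at_top. 0 = scaled_cdf \<Omega> \<mu> D X t 0"
        using eventually_gt_at_top[of 0]
      proof eventually_elim
        case (elim t)
        then show ?case using g_pos[of t] by (simp add: scaled_cdf_eq)
      qed
    qed
  qed (auto simp: trivial_limit_at_top_linorder)
  interpret N': real_distribution N' by (rule N'(1))
  have "(cdf N' \<longlongrightarrow> 0) (at_right 0)"
    using N'.cdf_is_right_cont[of 0] N'(2)[of 0] H0 by (simp add: continuous_within)
  then have "((\<lambda>x. cdf N' (1 - x)) \<longlongrightarrow> 0) (at_left 1)"
  proof (rule filterlim_compose)
    have "((\<lambda>x::real. 1 - x) \<longlongrightarrow> 1 - 1) (at_left 1)" by (intro tendsto_intros)
    then show "filterlim (\<lambda>x::real. 1 - x) (at_right 0) (at_left 1)"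
      by (auto simp: filterlim_at eventually_at_filter)
  qed
  then have "((\<lambda>x. 1 - cdf N' (1 - x)) \<longlongrightarrow> 1 - 0) (at_left 1)" by (intro tendsto_intros)
  moreover have "\<forall>\<^sub>F x in at_left (1::real). 1 - cdf N' (1 - x) = G x"
    using N'(2) by (auto simp: eventually_at_filter G_def)
  ultimately have "(G \<longlongrightarrow> 1) (at_left 1)" by (auto dest: Lim_transform_eventually)
  then have nontriv: "\<not> (G \<longlongrightarrow> 0) (at_left 1)"
    using tendsto_unique[of "at_left (1::real)" G 1 0] by auto
  show thesis
  proof (rule monotone_ratio_limit_powr[of g G])
    fix \<gamma> assume "0 \<le> \<gamma>" and G: "\<And>x. 0 < x \<Longrightarrow> x \<le> 1 \<Longrightarrow> G x = x powr \<gamma>"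
    show thesis
      by (rule that[OF \<open>0 \<le> \<gamma>\<close>]) (use G_lim G in auto)
  qed (use g_pos g_antimono G_lim nontriv in auto)
qed

context
  fixes \<gamma> :: real
  assumes \<gamma>: "0 \<le> \<gamma>"
    and ratio_lim: "\<And>x. 0 < x \<Longrightarrow> x \<le> 1 \<Longrightarrow> ((\<lambda>t. g t / g (x * t)) \<longlongrightarrow> x powr \<gamma>) at_top"
begin

lemma ratio_limit_imp_limiting_distribution:
  "is_limiting_distribution \<Omega> \<mu> D X (\<lambda>s. if s < 1 then 1 - (1 - s) powr \<gamma> else 1)"
  unfolding is_limiting_distribution_def
proof (intro conjI allI impI power_law_is_cdf[OF \<gamma>])
  fix s :: real assume s: "0 \<le> s"
  show "((\<lambda>t. scaled_cdf \<Omega> \<mu> D X t s) \<longlongrightarrow> (if s < 1 then 1 - (1 - s) powr \<gamma> else 1)) at_top"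
  proof (cases "s < 1")
    case True
    have "((\<lambda>t. 1 - g t / g ((1 - s) * t)) \<longlongrightarrow> 1 - (1 - s) powr \<gamma>) at_top"
      using True s by (intro tendsto_intros ratio_lim) auto
    then show ?thesis
      by (rule Lim_transform_eventually[OF _ eventually_mono[OF eventually_gt_at_top[of 0]], THEN tendsto_eq_rhs])
         (use True s in \<open>auto simp: scaled_cdf_eq\<close>)
  next
    case False
    have "\<forall>\<^sub>F t in at_top. 1 = scaled_cdf \<Omega> \<mu> D X t s"
      using eventually_gt_at_top[of 0] by eventually_elim (use False in \<open>simp add: scaled_cdf_ge_1\<close>)
    then show ?thesis
      using False by (auto intro: Lim_transform_eventually[OF tendsto_const])
  qed
qed

lemma scaled_moment_limit:
  "((\<lambda>t. expectation (\<lambda>\<omega>. scaled_sale_time \<mu> D X t \<omega> ^ Suc k))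
    \<longlongrightarrow> (LBINT s:{0..1}. real (Suc k) * s ^ k * (1 - s) powr \<gamma>)) at_top"
proof (rule Lim_transform_eventually)
  \<comment> \<open>Measurability and the bounds hold for positive \<open>t\<close>; only large \<open>t\<close> matter for the limit.\<close>
  let ?Y = "\<lambda>t. scaled_sale_time \<mu> D X (max t 1)"
  show "((\<lambda>t. expectation (\<lambda>\<omega>. ?Y t \<omega> ^ Suc k))
      \<longlongrightarrow> (LBINT s:{0..1}. real (Suc k) * s ^ k * (1 - s) powr \<gamma>)) at_top"
  proof (rule moment_limit)
    show "?Y t \<in> borel_measurable \<Omega>" for t by (intro scaled_measurable) simp
    show "AE \<omega> in \<Omega>. 0 \<le> ?Y t \<omega>" "AE \<omega> in \<Omega>. ?Y t \<omega> \<le> 1" for t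
      using scaled_bounds[of "max t 1"] by auto
    show "((\<lambda>t. prob {\<omega> \<in> space \<Omega>. s < ?Y t \<omega>}) \<longlongrightarrow> (1 - s) powr \<gamma>) at_top" if s: "0 \<le> s" "s < 1" for s
    proof (rule Lim_transform_eventually)
      show "((\<lambda>t. g t / g ((1 - s) * t)) \<longlongrightarrow> (1 - s) powr \<gamma>) at_top"
        using s by (intro ratio_lim) auto
      show "\<forall>\<^sub>F t in at_top. g t / g ((1 - s) * t) = prob {\<omega> \<in> space \<Omega>. s < ?Y t \<omega>}"
        using eventually_ge_at_top[of 1]
        by eventually_elim (use s prob_scaled_gt in \<open>simp add: max_absorb1\<close>)
    qed
  qed measurable
  show "\<forall>\<^sub>F t in at_top. expectation (\<lambda>\<omega>. ?Y t \<omega> ^ Suc k)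
      = expectation (\<lambda>\<omega>. scaled_sale_time \<mu> D X t \<omega> ^ Suc k)"
    using eventually_ge_at_top[of 1] by eventually_elim (simp add: max_absorb1)
qed

lemma scaled_mean_limit: "((\<lambda>t. expectation (scaled_sale_time \<mu> D X t)) \<longlongrightarrow> 1 / (\<gamma> + 1)) at_top"
  using scaled_moment_limit[of 0] integral_one_minus_powr(2)[OF \<gamma>] by simp

text \<open>
  Splitting \<open>s\<close> as \<open>1 - (1 - s)\<close> reduces the Beta integral to two integrals of powers.
\<close>

lemma scaled_second_moment_limit:
  "((\<lambda>t. expectation (\<lambda>\<omega>. (scaled_sale_time \<mu> D X t \<omega>)\<^sup>2)) \<longlongrightarrow> 2 / (\<gamma> + 1) - 2 / (\<gamma> + 2)) at_top"
proof -
  have int: "set_integrable lborel {0..1} (\<lambda>s. 2 * (1 - s) powr \<gamma>)"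
    "set_integrable lborel {0..1} (\<lambda>s. 2 * (1 - s) powr (\<gamma> + 1))"
    using integral_one_minus_powr(1)[of \<gamma>] integral_one_minus_powr(1)[of "\<gamma> + 1"] \<gamma>
    by (auto intro: set_integrable_mult_right)
  have "(LBINT s:{0..1}. real (Suc 1) * s ^ 1 * (1 - s) powr \<gamma>)
      = (LBINT s:{0..1}. 2 * (1 - s) powr \<gamma> - 2 * (1 - s) powr (\<gamma> + 1))"
  proof (rule set_lebesgue_integral_cong)
    show "\<forall>s. s \<in> {0..1} \<longrightarrow> real (Suc 1) * s ^ 1 * (1 - s) powr \<gamma> = 2 * (1 - s) powr \<gamma> - 2 * (1 - s) powr (\<gamma> + 1)"
    proof safe
      fix s :: real assume "s \<in> {0..1}"
      then have "(1 - s) powr (\<gamma> + 1) = (1 - s) powr \<gamma> * (1 - s)"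
        by (cases "s = 1") (auto simp: powr_add)
      then show "real (Suc 1) * s ^ 1 * (1 - s) powr \<gamma> = 2 * (1 - s) powr \<gamma> - 2 * (1 - s) powr (\<gamma> + 1)"
        by (simp add: algebra_simps)
    qed
  qed simp
  also have "\<dots> = 2 / (\<gamma> + 1) - 2 / (\<gamma> + 2)"
    using integral_one_minus_powr(2)[of \<gamma>] integral_one_minus_powr(2)[of "\<gamma> + 1"] \<gamma>
    by (subst set_integral_diff(2)[OF int]) (simp add: add.assoc)
  finally show ?thesis
    using scaled_moment_limit[of 1] by (simp add: numeral_2_eq_2)
qed

lemma scaled_variance_limit:
  "((\<lambda>t. variance (scaled_sale_time \<mu> D X t)) \<longlongrightarrow> \<gamma> / ((\<gamma> + 1)\<^sup>2 * (\<gamma> + 2))) at_top"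
proof (rule Lim_transform_eventually)
  let ?Y = "scaled_sale_time \<mu> D X"
  have "2 / (\<gamma> + 1) - 2 / (\<gamma> + 2) - (1 / (\<gamma> + 1))\<^sup>2 = \<gamma> / ((\<gamma> + 1)\<^sup>2 * (\<gamma> + 2))"
  proof -
    have "\<gamma> + 1 \<noteq> 0" "\<gamma> + 2 \<noteq> 0" using \<gamma> by auto
    then show ?thesis by (simp add: divide_simps power2_eq_square; simp add: algebra_simps)
  qed
  then show "((\<lambda>t. expectation (\<lambda>\<omega>. (?Y t \<omega>)\<^sup>2) - (expectation (?Y t))\<^sup>2) \<longlongrightarrow> \<gamma> / ((\<gamma> + 1)\<^sup>2 * (\<gamma> + 2))) at_top"
    using tendsto_diff[OF scaled_second_moment_limit tendsto_power[OF scaled_mean_limit, of 2]] by simp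
  show "\<forall>\<^sub>F t in at_top. expectation (\<lambda>\<omega>. (?Y t \<omega>)\<^sup>2) - (expectation (?Y t))\<^sup>2 = variance (?Y t)"
    using eventually_gt_at_top[of 0]
  proof eventually_elim
    case (elim t)
    have [measurable]: "?Y t \<in> borel_measurable \<Omega>" using elim by (intro scaled_measurable) simp
    have "integrable \<Omega> (?Y t)" "integrable \<Omega> (\<lambda>\<omega>. (?Y t \<omega>)\<^sup>2)"
      using scaled_bounds[OF elim]
      by (auto intro!: integrable_const_bound[where B = 1] abs_square_le_1[THEN iffD2] elim!: eventually_mono)
    then show ?case by (simp add: variance_eq)
  qed
qed

lemma scaled_expectation: "expectation (scaled_sale_time \<mu> D X t) = expectation (sale_time \<mu> D X t) / t"
  by (simp add: scaled_sale_time_def[abs_def])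

lemma mean_limit: "((\<lambda>t. expectation (sale_time \<mu> D X t) / t) \<longlongrightarrow> 1 / (\<gamma> + 1)) at_top"
  using scaled_mean_limit by (simp add: scaled_expectation)

lemma variance_limit:
  "((\<lambda>t. variance (sale_time \<mu> D X t) / t\<^sup>2) \<longlongrightarrow> \<gamma> / ((\<gamma> + 1)\<^sup>2 * (\<gamma> + 2))) at_top"
proof -
  have "variance (scaled_sale_time \<mu> D X t) = variance (sale_time \<mu> D X t) / t\<^sup>2" for t
    unfolding scaled_expectation by (simp add: scaled_sale_time_def power_divide flip: diff_divide_distrib)
  then show ?thesis using scaled_variance_limit by simp
qed

end

end

section \<open>The limit theorem under the optimal policy\<close>

theorem theorem5p4:
  fixes \<Omega> :: "'w measure" and lam :: real and F F0 :: "real \<Rightarrow> real"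
    and D X :: "nat \<Rightarrow> 'w \<Rightarrow> real"
  defines "\<mu> \<equiv> opt_policy lam F F0"
    and "\<mu>' \<equiv> opt_policy_deriv lam F F0"
  defines "T \<equiv> sale_time \<mu> D X"
    and "T_hat \<equiv> scaled_sale_time \<mu> D X"
  assumes lam: "0 < lam"
    and F: "is_cdf F" and F0: "is_cdf F0"
    and EX: "integrable (interval_measure F) (\<lambda>x. max x 0)"
    and EX0: "integrable (interval_measure F0) (\<lambda>x. \<bar>x\<bar>)"
    and mean_nonneg: "0 \<le> dist_mean F0"
    and mean_less: "ereal (dist_mean F0) < upper_end F"
    and prob: "prob_space \<Omega>"
    and indep: "prob_space.indep_vars \<Omega> (\<lambda>_. borel) (case_sum D X) ({1..} <+> {1..})"
    and D: "\<And>i. 1 \<le> i \<Longrightarrow> distributed \<Omega> lborel (D i) (exponential_density lam)"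
    and X: "\<And>i. 1 \<le> i \<Longrightarrow> cdf (distr \<Omega> borel (X i)) = F"
  shows "((\<exists>H. is_limiting_distribution \<Omega> \<mu> D X H) \<longleftrightarrow> (\<exists>\<rho>\<le>0. regularly_varying \<mu>' \<rho>)) \<and>
    (\<forall>\<rho>\<le>0. \<forall>\<gamma>. regularly_varying \<mu>' \<rho> \<and> \<gamma> = - \<rho> \<longrightarrow>
       is_limiting_distribution \<Omega> \<mu> D X (\<lambda>s. if s < 1 then 1 - (1 - s) powr \<gamma> else 1) \<and>
       ((\<lambda>t. prob_space.expectation \<Omega> (T t) / t) \<longlongrightarrow> 1 / (\<gamma> + 1)) at_top \<and>
       ((\<lambda>t. prob_space.expectation \<Omega> (T_hat t)) \<longlongrightarrow> 1 / (\<gamma> + 1)) at_top \<and>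
       ((\<lambda>t. prob_space.variance \<Omega> (T t) / t\<^sup>2) \<longlongrightarrow> \<gamma> / ((\<gamma> + 1)\<^sup>2 * (\<gamma> + 2))) at_top \<and>
       ((\<lambda>t. prob_space.variance \<Omega> (T_hat t)) \<longlongrightarrow> \<gamma> / ((\<gamma> + 1)\<^sup>2 * (\<gamma> + 2))) at_top)"
proof -
  interpret \<Omega>: prob_space \<Omega> by (rule prob)
  obtain N where N: "real_distribution N" "cdf N = F"
    using F by (auto simp: is_cdf_def)
  interpret N: real_distribution N by (rule N(1))
  have "N = interval_measure F"
    using N real_distribution_interval_measure[of F] cdf_interval_measure[of F]
      N.cdf_nondecreasing N.cdf_is_right_cont N.cdf_lim_at_bot N.cdf_lim_at_top_prob
    by (intro cdf_unique) auto
  then interpret P: optimal_policy N F lam F0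
    using N EX lam mean_less by unfold_locales auto
  have X_measurable: "X i \<in> borel_measurable \<Omega>" if "1 \<le> i" for i
    using indep that by (auto simp: \<Omega>.indep_vars_def dest: bspec[where x="Inr i"])
  have X_distr: "distr \<Omega> borel (X i) = N" if "1 \<le> i" for i
    using X[OF that] N \<Omega>.real_distribution_distr[OF X_measurable[OF that]] by (intro cdf_unique) auto
  define C where "C = {u. 0 < u \<and> \<not> isCont F (\<mu> u)}"
  have "countable C"
  proof (rule countable_image_inj_on)
    have "mono F" by (rule monoI) (rule P.F_mono)
    then have "countable {x. \<not> isCont F x}" by (rule mono_ctble_discont)
    then show "countable (\<mu> ` C)" by (rule countable_subset[rotated]) (auto simp: C_def)
    show "inj_on \<mu> C"
      unfolding \<mu>_def C_def by (rule linorder_inj_onI) (auto dest: P.policy_strict_mono[rotated])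
  qed
  have \<mu>'_eq: "\<mu>' t = lam * phi F (\<mu> t)" if "0 \<le> t" for t
    using P.policy_deriv_eq[OF that] by (simp add: \<mu>_def \<mu>'_def)
  have \<mu>'_deriv: "(\<mu>' has_real_derivative - (lam * measure N {\<mu> u..} * \<mu>' u)) (at u)" if u: "0 < u" "u \<notin> C" for u
  proof -
    have "isCont F (\<mu> u)" using u by (simp add: C_def)
    then have "((\<lambda>t. lam * phi F (\<mu> t)) has_real_derivative - (lam * measure N {\<mu> u..} * \<mu>' u)) (at u)"
      using P.speed_has_derivative[of u] u by (simp add: \<mu>_def \<mu>'_eq)
    then show ?thesis
      by (rule has_field_derivative_transform_within_open[where S = "{0<..}"]) (use u in \<open>auto simp: \<mu>'_eq\<close>)
  qed
  have \<mu>'_lip: "(lam * \<mu>' 0)-lipschitz_on {0..} \<mu>'"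
  proof (rule lipschitz_on_transform)
    show "(lam * \<mu>' 0)-lipschitz_on {0..} (\<lambda>t. lam * phi F (\<mu> t))"
      using P.speed_lipschitz by (simp add: \<mu>'_eq \<mu>_def)
  qed (simp add: \<mu>'_eq)
  interpret B: bidding_process \<Omega> lam \<mu> \<mu>' N D X "lam * \<mu>' 0" C
    using lam indep D X_distr \<mu>'_lip \<open>countable C\<close> \<mu>'_deriv P.policy_continuous P.speed_pos P.speed_antimono
    by unfold_locales (auto simp: \<mu>'_eq \<mu>_def)
  have rv_iff: "regularly_varying \<mu>' \<rho> \<longleftrightarrow>
      (\<forall>x. 0 < x \<and> x \<le> 1 \<longrightarrow> ((\<lambda>t. \<mu>' t / \<mu>' (x * t)) \<longlongrightarrow> x powr (- \<rho>)) at_top)" for \<rho>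
    using B.g_pos lipschitz_on_continuous_on[OF \<mu>'_lip] by (rule regularly_varying_iff_ratio_limit)
  have only_if: "\<exists>\<rho>\<le>0. regularly_varying \<mu>' \<rho>" if lim: "is_limiting_distribution \<Omega> \<mu> D X H" for H
  proof (rule B.limiting_distribution_imp_ratio_limit[OF lim])
    fix \<gamma> assume "0 \<le> \<gamma>" "\<And>x. 0 < x \<Longrightarrow> x \<le> 1 \<Longrightarrow> ((\<lambda>t. \<mu>' t / \<mu>' (x * t)) \<longlongrightarrow> x powr \<gamma>) at_top"
    then show ?thesis by (intro exI[of _ "- \<gamma>"]) (simp add: rv_iff)
  qed
  have if_rv: "is_limiting_distribution \<Omega> \<mu> D X (\<lambda>s. if s < 1 then 1 - (1 - s) powr \<gamma> else 1) \<and>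
       ((\<lambda>t. \<Omega>.expectation (T t) / t) \<longlongrightarrow> 1 / (\<gamma> + 1)) at_top \<and>
       ((\<lambda>t. \<Omega>.expectation (T_hat t)) \<longlongrightarrow> 1 / (\<gamma> + 1)) at_top \<and>
       ((\<lambda>t. \<Omega>.variance (T t) / t\<^sup>2) \<longlongrightarrow> \<gamma> / ((\<gamma> + 1)\<^sup>2 * (\<gamma> + 2))) at_top \<and>
       ((\<lambda>t. \<Omega>.variance (T_hat t)) \<longlongrightarrow> \<gamma> / ((\<gamma> + 1)\<^sup>2 * (\<gamma> + 2))) at_top"
    if "\<rho> \<le> 0" "regularly_varying \<mu>' \<rho>" "\<gamma> = - \<rho>" for \<rho> \<gamma>
  proof -
    have \<gamma>: "0 \<le> \<gamma>" using that by simp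
    have lim: "((\<lambda>t. \<mu>' t / \<mu>' (x * t)) \<longlongrightarrow> x powr \<gamma>) at_top" if "0 < x" "x \<le> 1" for x
      using \<open>regularly_varying \<mu>' \<rho>\<close> that by (simp add: rv_iff \<open>\<gamma> = - \<rho>\<close>)
    show ?thesis
      unfolding T_def T_hat_def
      by (intro conjI B.ratio_limit_imp_limiting_distribution[OF \<gamma> lim] B.mean_limit[OF \<gamma> lim]
          B.scaled_mean_limit[OF \<gamma> lim] B.variance_limit[OF \<gamma> lim] B.scaled_variance_limit[OF \<gamma> lim])
  qed
  show ?thesis
  proof (intro conjI iffI allI impI)
    assume "\<exists>H. is_limiting_distribution \<Omega> \<mu> D X H"
    then show "\<exists>\<rho>\<le>0. regularly_varying \<mu>' \<rho>" using only_if by blast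
  next
    assume "\<exists>\<rho>\<le>0. regularly_varying \<mu>' \<rho>"
    then obtain \<rho> where "\<rho> \<le> 0" "regularly_varying \<mu>' \<rho>" by blast
    from if_rv[OF this refl] show "\<exists>H. is_limiting_distribution \<Omega> \<mu> D X H" by blast
  qed (use if_rv in simp_all)
qed

end
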